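(* Let $d\in\mathbb{N}=\{1,2,\ldots\}$ and let $X$ be a $\mathbb{Z}^d$-valued random vector with distribution $\mu$. Then the following are equivalent: (i) $\mu$ is infinitely divisible. (ii) $\mathcal{L}(a^T X)$ is infinitely divisible for all $a\in \mathbb{R}^d$. (iii) $\mathcal{L}(a^T X)$ is infinitely divisible for all $a\in \mathbb{N}_0^d$. (iv) The characteristic function $\widehat{\mu}$ of $\mu$ has no zeroes on $\mathbb{R}^d$ and there exists some $a=(a_1,\ldots,a_d)^T\in\mathbb{R}^d$ such that $a_1,\ldots,a_d$ are linearly independent over $\mathbb{Q}$ and such that $\mathcal{L}(a^T X)$ is infinitely divisible. (v) There exists a sequence $(a(n))_{n\in\mathbb{N}}$ of vectors in $\mathbb{R}^d\setminus\{0\}$ such that the closure of $\{|a(n)|^{-1}a(n) : n\in\mathbb{N}\}$ has non-empty interior in the relative topology of the unit sphere $S^{d-1}=\{x\in\mathbb{R}^d : |x|=1\}$ and such that $\mathcal{L}(a(n)^T X)$ is infinitely divisible for all $n\in\mathbb{N}$.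
   Context: $\mathbb{N}=\{1,2,3,\ldots\}$ and $\mathbb{N}_0=\mathbb{N}\cup\{0\}$. $|\cdot|$ is the Euclidean norm on $\mathbb{R}^d$; vectors are column vectors and $a^T$ denotes the transpose, so $a^TX$ is a real-valued random variable. $\mathcal{L}(Y)$ denotes the law (distribution) of a random vector $Y$. A distribution on $\mathbb{Z}^d$ is viewed as a Borel probability measure on $\mathbb{R}^d$ concentrated on $\mathbb{Z}^d$. The characteristic function of a probability measure $\mu$ on $\mathbb{R}^d$ is $\widehat{\mu}(z)=\int_{\mathbb{R}^d} e^{i\langle z,x\rangle}\,\mu(dx)$, $z\in\mathbb{R}^d$, where $\langle z,x\rangle=z^Tx$. A probability distribution $\mu$ on $\mathbb{R}^m$ is infinitely divisible if for every $n\in\mathbb{N}$ there exists a probability distribution $\mu_n$ on $\mathbb{R}^m$ such that $\mu=\mu_n^{\ast n}$, the $n$-fold convolution of $\mu_n$ with itself. *)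

theory Defs
  imports "HOL-Probability.Probability"
begin

primrec conv_power :: "nat \<Rightarrow> 'a::ordered_euclidean_space measure \<Rightarrow> 'a measure" where
  "conv_power 0 \<nu> = return borel 0"
| "conv_power (Suc n) \<nu> = convolution \<nu> (conv_power n \<nu>)"

definition infinitely_divisible :: "'a::ordered_euclidean_space measure \<Rightarrow> bool" where
  "infinitely_divisible \<mu> \<longleftrightarrow>
     (\<forall>n\<ge>1. \<exists>\<nu>. prob_space \<nu> \<and> sets \<nu> = sets borel \<and> \<mu> = conv_power n \<nu>)"

text \<open>The library's \<^const>\<open>char\<close> covers measures on the real line only.\<close>

definition char_vec :: "'a::euclidean_space measure \<Rightarrow> 'a \<Rightarrow> complex" where
  "char_vec \<mu> z = (CLINT x|\<mu>. iexp (z \<bullet> x))"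

text \<open>Linear independence over the rationals of the \<^emph>\<open>family\<close> of coordinates of a vector. The
  library's \<^const>\<open>module.dependent\<close> is about sets, so that it would not notice repeated coordinates.\<close>

definition rat_independent_coords :: "real ^ 'd \<Rightarrow> bool" where
  "rat_independent_coords a \<longleftrightarrow>
     (\<forall>q :: 'd \<Rightarrow> rat. (\<Sum>i\<in>UNIV. of_rat (q i) * a $ i) = 0 \<longrightarrow> (\<forall>i. q i = 0))"

lemma char_vec_real: "char_vec \<mu> = char \<mu>"
  by (simp add: fun_eq_iff char_vec_def char_def)

lemma module_rat_real: "module (\<lambda>(r::rat) (x::real). of_rat r * x)"
  by unfold_locales (auto simp: algebra_simps of_rat_add of_rat_mult)

lemma rat_independent_coords_iff_module:
  "rat_independent_coords a \<longleftrightarrow>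
     inj (($) a) \<and> \<not> module.dependent (\<lambda>(r::rat) (x::real). of_rat r * x) (range (($) a))"
proof -
  interpret Q: module "\<lambda>(r::rat) (x::real). of_rat r * x" by (rule module_rat_real)
  show ?thesis
  proof (intro iffI conjI)
    assume ind: "rat_independent_coords a"
    show inj: "inj (($) a)"
    proof (rule injI, rule ccontr)
      fix i j assume eq: "a $ i = a $ j" and ne: "i \<noteq> j"
      define q :: "'a \<Rightarrow> rat" where "q = (\<lambda>k. if k = i then 1 else if k = j then - 1 else 0)"
      have "(\<Sum>k\<in>UNIV. of_rat (q k) * a $ k)
              = (\<Sum>k\<in>UNIV. (if k = i then a $ k else 0) - (if k = j then a $ k else 0))"
        by (rule sum.cong) (use ne in \<open>auto simp: q_def\<close>)
      also have "\<dots> = 0"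
        by (simp add: sum_subtractf eq)
      finally have "q i = 0"
        using ind by (auto simp: rat_independent_coords_def)
      then show False by (simp add: q_def)
    qed
    show "Q.independent (range (($) a))"
      unfolding Q.independent_explicit_module
    proof (intro allI impI)
      fix A u v
      assume A: "finite A" "A \<subseteq> range (($) a)" and 0: "(\<Sum>v\<in>A. of_rat (u v) * v) = 0" and v: "v \<in> A"
      define q where "q = (\<lambda>k. if a $ k \<in> A then u (a $ k) else 0)"
      have "(\<Sum>k\<in>UNIV. of_rat (q k) * a $ k) = (\<Sum>x\<in>range (($) a). of_rat (if x \<in> A then u x else 0) * x)"
        by (simp add: sum.reindex[OF inj] q_def)
      also have "\<dots> = (\<Sum>v\<in>A. of_rat (u v) * v)"
        by (rule sum.mono_neutral_cong_right) (use A in auto)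
      finally have "q k = 0" for k
        using ind 0 by (auto simp: rat_independent_coords_def)
      moreover obtain k where "v = a $ k" using A v by auto
      ultimately show "u v = 0" using v by (auto simp: q_def dest: meta_spec[of _ k] split: if_splits)
    qed
  next
    assume *: "inj (($) a) \<and> Q.independent (range (($) a))"
    show "rat_independent_coords a"
      unfolding rat_independent_coords_def
    proof (intro allI impI)
      fix q :: "'a \<Rightarrow> rat" and i
      assume 0: "(\<Sum>i\<in>UNIV. of_rat (q i) * a $ i) = 0"
      have inj: "inj (($) a)" using * by blast
      have "(\<Sum>x\<in>range (($) a). of_rat (q (inv (($) a) x)) * x) = 0"
        using 0 by (simp add: sum.reindex[OF inj] inj)
      then have "q (inv (($) a) (a $ i)) = 0"
        using * unfolding Q.independent_explicit_module
        by (meson finite_imageI finite subset_refl rangeI)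
      then show "q i = 0" by (simp add: inj)
    qed
  qed
qed

end

theory Submission
  imports Defs
begin

text \<open>
  Let \<open>\<phi>\<close> be the characteristic function of \<open>\<mu>\<close>; it is continuous and \<open>2\<pi>\<int>\<^sup>d\<close>-periodic. For (iv) \<open>\<Rightarrow>\<close> (i),
  take the continuous logarithm \<open>\<psi>\<close> of \<open>\<phi>\<close> with \<open>\<psi>(0) = 0\<close>. It is periodic up to a linear term
  \<open>\<i>\<langle>m, z\<rangle>\<close> with \<open>m \<in> \<int>\<^sup>d\<close>, and a convolution root \<open>\<nu>\<close> of order \<open>n\<close> of the law of \<open>a\<^sup>T X\<close> has characteristic
  function \<open>t \<mapsto> exp (\<psi>(ta)/n)\<close>. Hence a translate of \<open>\<nu>\<close> has characteristic function \<open>t \<mapsto> h(ta)\<close> with \<open>h\<close>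
  continuous and periodic, and such a law lives on \<open>{\<langle>a, k\<rangle> : k \<in> \<int>\<^sup>d}\<close>: average \<open>h(ta)\<close> over \<open>t\<close> against
  a nonnegative trigonometric polynomial that is concentrated near those \<open>t\<close> with \<open>ta\<close> close to \<open>2\<pi>\<int>\<^sup>d\<close>. Since
  \<open>x \<mapsto> \<langle>a, x\<rangle>\<close> is injective on \<open>\<int>\<^sup>d\<close>, the root \<open>\<nu>\<close> pulls back to a convolution root of \<open>\<mu>\<close>.

  The set of \<open>a\<close> for which the law of \<open>a\<^sup>T X\<close> is infinitely divisible is closed under scaling and under
  limits. Under (iii) or (v) it therefore contains an open cone, which has rationally independent
  elements and meets every coset of \<open>2\<pi>\<int>\<^sup>d\<close>; the latter makes \<open>\<phi>\<close> zero-free.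
\<close>

section \<open>Convolution powers and characteristic functions on the line\<close>

lemma real_distribution_iff_prob_space_borel:
  "real_distribution \<nu> \<longleftrightarrow> prob_space \<nu> \<and> sets \<nu> = sets borel" for \<nu> :: "real measure"
  by (auto simp: real_distribution_def real_distribution_axioms_def)

section \<open>Convolutions under additive maps, and their supports\<close>

lemma prob_space_convolution:
  fixes M N :: "'a::ordered_euclidean_space measure"
  assumes "prob_space M" "prob_space N" and [measurable_cong]: "sets M = sets borel" "sets N = sets borel"
  shows "prob_space (convolution M N)"
proof -
  interpret M: prob_space M by fact
  interpret N: prob_space N by fact
  interpret P: pair_prob_space M N ..
  show ?thesis unfolding convolution_def by (rule P.prob_space_distr) measurable
qed

lemma sets_conv_power: "sets (conv_power n \<nu>) = sets borel"
  by (cases n) auto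

lemma prob_space_conv_power:
  assumes "prob_space \<nu>" "sets \<nu> = sets borel"
  shows "prob_space (conv_power n \<nu>)"
  by (induction n) (auto intro!: prob_space_return prob_space_convolution assms simp: sets_conv_power)

lemma distr_convolution:
  fixes M N :: "'a::ordered_euclidean_space measure" and f :: "'a \<Rightarrow> 'b::ordered_euclidean_space"
  assumes "prob_space M" "prob_space N" and [measurable_cong]: "sets M = sets borel" "sets N = sets borel"
    and [measurable]: "f \<in> borel_measurable borel" and add: "\<And>x y. f (x + y) = f x + f y"
  shows "distr (convolution M N) borel f = convolution (distr M borel f) (distr N borel f)"
proof -
  interpret M: prob_space M by fact
  interpret N: prob_space N by fact
  interpret N': prob_space "distr N borel f" by (rule N.prob_space_distr) simp
  have "convolution (distr M borel f) (distr N borel f)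
      = distr (distr (M \<Otimes>\<^sub>M N) (borel \<Otimes>\<^sub>M borel) (\<lambda>(x, y). (f x, f y))) borel (\<lambda>(x, y). x + y)"
    unfolding convolution_def
    by (subst pair_measure_distr) (auto intro: N'.sigma_finite_measure_axioms)
  also have "\<dots> = distr (convolution M N) borel f"
    unfolding convolution_def
    by (subst (1 2) distr_distr) (auto simp: add comp_def case_prod_beta intro!: distr_cong)
  finally show ?thesis by simp
qed

lemma distr_conv_power:
  fixes \<nu> :: "'a::ordered_euclidean_space measure" and f :: "'a \<Rightarrow> 'b::ordered_euclidean_space"
  assumes "prob_space \<nu>" "sets \<nu> = sets borel" "f \<in> borel_measurable borel"
    and add: "\<And>x y. f (x + y) = f x + f y"
  shows "distr (conv_power n \<nu>) borel f = conv_power n (distr \<nu> borel f)"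
proof (induction n)
  case 0
  have "f 0 = 0" using add[of 0 0] by simp
  then show ?case using assms by (simp add: distr_return)
next
  case (Suc n)
  then show ?case
    by (simp add: distr_convolution assms sets_conv_power prob_space_conv_power)
qed

text \<open>An additive map carries convolution roots to convolution roots. Inner products give the
  passage from a law to its projections, multiplication by a constant the scaling of
  directions.\<close>

lemma infinitely_divisible_distr:
  fixes \<nu> :: "'a::ordered_euclidean_space measure" and f :: "'a \<Rightarrow> 'b::ordered_euclidean_space"
  assumes id: "infinitely_divisible \<mu>" and [measurable]: "f \<in> borel_measurable borel"
    and add: "\<And>x y. f (x + y) = f x + f y"
  shows "infinitely_divisible (distr \<mu> borel f)"
  unfolding infinitely_divisible_def
proof (intro allI impI)
  fix n :: nat assume "n \<ge> 1"
  then obtain \<nu> where \<nu>: "prob_space \<nu>" "sets \<nu> = sets borel" "\<mu> = conv_power n \<nu>"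
    using id by (auto simp: infinitely_divisible_def)
  then show "\<exists>\<nu>. prob_space \<nu> \<and> sets \<nu> = sets borel \<and> distr \<mu> borel f = conv_power n \<nu>"
    by (intro exI[of _ "distr \<nu> borel f"])
       (auto simp: distr_conv_power add cong: measurable_cong_sets intro!: prob_space.prob_space_distr)
qed

lemma AE_convolution:
  fixes M N :: "'a::ordered_euclidean_space measure"
  assumes "prob_space M" "prob_space N" and [measurable_cong]: "sets M = sets borel" "sets N = sets borel"
    and M: "AE x in M. x \<in> A" and N: "AE y in N. y \<in> B"
    and C: "\<And>x y. x \<in> A \<Longrightarrow> y \<in> B \<Longrightarrow> x + y \<in> C" and [measurable]: "C \<in> sets borel"
  shows "AE z in convolution M N. z \<in> C"
proof -
  interpret M: prob_space M by fact
  interpret N: prob_space N by fact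
  interpret P: pair_prob_space M N ..
  have "AE p in M \<Otimes>\<^sub>M N. fst p + snd p \<in> C"
  proof (rule P.AE_pair_measure)
    show "AE x in M. AE y in N. fst (x, y) + snd (x, y) \<in> C"
      using M by eventually_elim (use N in eventually_elim, auto intro: C)
  qed measurable
  then show ?thesis
    unfolding convolution_def by (subst AE_distr_iff) (auto simp: case_prod_beta)
qed

section \<open>Characteristic functions of convolutions, and their zeros\<close>

lemma char_convolution:
  assumes "real_distribution M" "real_distribution N"
  shows "char (convolution M N) t = char M t * char N t"
proof -
  interpret M: real_distribution M by fact
  interpret N: real_distribution N by fact
  interpret P: pair_prob_space M N ..
  have "char (convolution M N) t = (CLINT p|M \<Otimes>\<^sub>M N. iexp (t * (fst p + snd p)))"
    unfolding char_def convolution_def by (subst integral_distr) (auto simp: case_prod_beta)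
  also have "\<dots> = (CLINT x|M. CLINT y|N. iexp (t * (x + y)))"
    by (subst P.integral_fst'[symmetric])
      (auto intro!: P.integrable_const_bound[where B=1] simp del: of_real_mult of_real_add)
  also have "\<dots> = char M t * char N t"
    by (simp add: char_def distrib_left exp_add)
  finally show ?thesis .
qed

lemma char_return: "char (return borel c) t = iexp (t * c)"
  unfolding char_def by (subst integral_return) auto

lemma char_distr:
  assumes [measurable]: "f \<in> borel_measurable M"
  shows "char (distr M borel f) t = (CLINT x|M. iexp (t * f x))"
  unfolding char_def by (subst integral_distr) auto

lemma char_conv_power:
  assumes "real_distribution \<nu>"
  shows "char (conv_power n \<nu>) t = char \<nu> t ^ n"
proof (induction n)
  case (Suc n)
  have "real_distribution (conv_power n \<nu>)"
    using assms by (simp add: real_distribution_iff_prob_space_borel prob_space_conv_power sets_conv_power)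
  with Suc assms show ?case by (simp add: char_convolution)
qed (simp add: char_return)

text \<open>By Levy's uniqueness theorem an equation between measures is one between characteristic
  functions, where an \<open>n\<close>-fold convolution is an \<open>n\<close>-th power.\<close>

lemma infinitely_divisible_real_iff:
  assumes "real_distribution \<mu>"
  shows "infinitely_divisible \<mu> \<longleftrightarrow> (\<forall>n\<ge>1. \<exists>\<nu>. real_distribution \<nu> \<and> (\<forall>t. char \<mu> t = char \<nu> t ^ n))"
proof -
  have "\<mu> = conv_power n \<nu> \<longleftrightarrow> (\<forall>t. char \<mu> t = char \<nu> t ^ n)" if "real_distribution \<nu>" for n \<nu>
  proof
    have "real_distribution (conv_power n \<nu>)"
      using that by (simp add: real_distribution_iff_prob_space_borel prob_space_conv_power sets_conv_power)
    then show "\<mu> = conv_power n \<nu>" if "\<forall>t. char \<mu> t = char \<nu> t ^ n"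
      using that \<open>real_distribution \<nu>\<close> assms by (intro Levy_uniqueness) (auto simp: char_conv_power fun_eq_iff)
  qed (use that in \<open>auto simp: char_conv_power\<close>)
  then show ?thesis
    unfolding infinitely_divisible_def real_distribution_iff_prob_space_borel[symmetric] conj_assoc[symmetric]
    by metis
qed

text \<open>The pointwise bound \<open>1 - cos (2 * x) \<le> 4 * (1 - cos x)\<close>, integrated;
  the gap is twice a square.\<close>

lemma (in real_distribution) char_doubling: "1 - Re (char M (2 * t)) \<le> 4 * (1 - Re (char M t))"
proof -
  have Re: "Re (char M s) = (\<integral>x. cos (s * x) \<partial>M)" for s
    unfolding char_def
    by (subst integral_Re[symmetric])
      (auto intro!: integrable_const_bound[where B=1] simp: Re_exp simp del: of_real_mult)
  have int: "integrable M (\<lambda>x. cos (s * x))" for s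
    by (rule integrable_const_bound[where B=1]) auto
  have "0 \<le> (\<integral>x. 4 * (1 - cos (t * x)) - (1 - cos (2 * t * x)) \<partial>M)"
  proof (rule Bochner_Integration.integral_nonneg)
    fix x
    have "4 * (1 - cos (t * x)) - (1 - cos (2 * t * x)) = 2 * (1 - cos (t * x))\<^sup>2"
      using cos_double_cos[of "t * x"] by (simp add: algebra_simps power2_eq_square)
    then show "0 \<le> 4 * (1 - cos (t * x)) - (1 - cos (2 * t * x))" by simp
  qed
  also have "\<dots> = 4 * (1 - Re (char M t)) - (1 - Re (char M (2 * t)))"
    using int[of t] int[of "2 * t"] by (simp add: Re prob_space[simplified])
  finally show ?thesis by simp
qed

text \<open>Applied to the symmetrization, whose characteristic function is the squared modulus.\<close>

lemma (in real_distribution) cmod_char_doubling: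
  "1 - (cmod (char M (2 * t)))\<^sup>2 \<le> 4 * (1 - (cmod (char M t))\<^sup>2)"
proof -
  have R: "real_distribution (distr M borel uminus)"
    by (rule real_distribution_distr) simp
  have "char (distr M borel uminus) s = cnj (char M s)" for s
    unfolding char_def[of M] by (simp add: char_distr exp_cnj flip: Bochner_Integration.integral_cnj)
  then have "char (convolution M (distr M borel uminus)) s = of_real ((cmod (char M s))\<^sup>2)" for s
    using R by (simp add: char_convolution real_distribution_axioms complex_norm_square del: of_real_power)
  moreover have "real_distribution (convolution M (distr M borel uminus))"
    using R by (simp add: real_distribution_iff_prob_space_borel prob_space_convolution prob_space_axioms)
  ultimately show ?thesis
    using real_distribution.char_doubling[of "convolution M (distr M borel uminus)" t] by (simp del: of_real_power)
qed

text \<open>At a point where the characteristic function is nonzero, its roots of large order have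
  modulus near 1, so the doubling bound keeps it nonzero at twice the point. Repeated doubling from
  a neighbourhood of 0 reaches every \<open>t\<close>.\<close>

lemma infinitely_divisible_char_nonzero:
  assumes rd: "real_distribution \<mu>" and id: "infinitely_divisible \<mu>"
  shows "char \<mu> t \<noteq> 0"
proof -
  interpret real_distribution \<mu> by fact
  have double: "char \<mu> (2 * s) \<noteq> 0" if s: "char \<mu> s \<noteq> 0" for s
  proof -
    have "(\<lambda>n. root n ((cmod (char \<mu> s))\<^sup>2)) \<longlonglongrightarrow> 1"
      using s by (intro LIMSEQ_root_const) auto
    \<comment> \<open>Above 3/4 the doubling bound gives
      \<open>1 - (cmod (char \<nu> (2 * s)))\<^sup>2 < 1\<close>.\<close>
    then have "\<forall>\<^sub>F n in sequentially. 3/4 < root n ((cmod (char \<mu> s))\<^sup>2)"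
      by (rule order_tendstoD) simp
    then obtain n where n: "n \<ge> 1" "3/4 < root n ((cmod (char \<mu> s))\<^sup>2)"
      by (metis eventually_sequentially linorder_le_cases order_refl)
    then obtain \<nu> where \<nu>: "real_distribution \<nu>" "\<And>t. char \<mu> t = char \<nu> t ^ n"
      using id rd infinitely_divisible_real_iff by blast
    have "(cmod (char \<mu> s))\<^sup>2 = ((cmod (char \<nu> s))\<^sup>2) ^ n"
      by (simp add: \<nu> norm_power mult.commute flip: power_mult)
    then have "3/4 < (cmod (char \<nu> s))\<^sup>2"
      using n by (simp add: real_root_power_cancel)
    then have "cmod (char \<nu> (2 * s)) \<noteq> 0"
      using real_distribution.cmod_char_doubling[OF \<nu>(1), of s] by auto
    then show ?thesis by (simp add: \<nu>)
  qed
  have "isCont (\<lambda>s. char \<mu> s) 0" by (rule isCont_char)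
  then have "((\<lambda>k. char \<mu> (t / 2 ^ k)) \<longlonglongrightarrow> char \<mu> 0)"
    by (rule isCont_tendsto_compose) real_asymp
  then have "((\<lambda>k. char \<mu> (t / 2 ^ k)) \<longlonglongrightarrow> 1)" by (simp add: char_zero)
  then have "\<forall>\<^sub>F k in sequentially. char \<mu> (t / 2 ^ k) \<noteq> 0"
    by (rule tendsto_imp_eventually_ne) simp
  then obtain k where "char \<mu> (t / 2 ^ k) \<noteq> 0"
    by (auto simp: eventually_sequentially)
  then show ?thesis
  proof (induction k)
    case (Suc k)
    then show ?case using double[of "t / 2 ^ Suc k"] by simp
  qed simp
qed

section \<open>Gaussian means of trigonometric polynomials\<close>

abbreviation gauss_mean :: "nat \<Rightarrow> (real \<Rightarrow> complex) \<Rightarrow> complex" where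
  "gauss_mean n f \<equiv> (CLINT s|std_normal_distribution. f (real n * s))"

text \<open>Fubini turns the Gaussian mean into the integral over \<open>\<rho>\<close> of a
  Gaussian in \<open>n * (y + x)\<close>, which converges boundedly to the indicator of
  \<open>{- y}\<close>. The limit thus reads off one atom.\<close>

lemma gauss_mean_char_tendsto:
  assumes "real_distribution \<rho>"
  shows "(\<lambda>n. gauss_mean n (\<lambda>t. iexp (t * y) * char \<rho> t)) \<longlonglongrightarrow> measure \<rho> {- y}"
proof -
  interpret \<rho>: real_distribution \<rho> by fact
  interpret N: real_distribution std_normal_distribution by (rule real_dist_normal_dist)
  interpret P: pair_prob_space std_normal_distribution \<rho> ..
  have "gauss_mean n (\<lambda>t. iexp (t * y) * char \<rho> t)
      = (CLINT x|\<rho>. of_real (exp (- ((real n * (y + x))\<^sup>2 / 2))))" for n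
  proof -
    have "gauss_mean n (\<lambda>t. iexp (t * y) * char \<rho> t)
        = (CLINT s|std_normal_distribution. CLINT x|\<rho>. iexp (real n * s * (y + x)))"
      by (simp add: char_def distrib_left exp_add)
    also have "\<dots> = (CLINT x|\<rho>. CLINT s|std_normal_distribution. iexp (real n * s * (y + x)))"
      by (rule P.Fubini_integral[symmetric])
        (auto intro!: P.integrable_const_bound[where B=1] simp: case_prod_beta simp del: of_real_mult of_real_add)
    also have "\<dots> = (CLINT x|\<rho>. char std_normal_distribution (real n * (y + x)))"
      unfolding char_def by (simp add: mult_ac)
    finally show ?thesis by (simp add: char_std_normal_distribution)
  qed
  moreover have "(\<lambda>n. CLINT x|\<rho>. of_real (exp (- ((real n * (y + x))\<^sup>2 / 2)))) \<longlonglongrightarrow> (CLINT x|\<rho>. of_real (indicator {- y} x))"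
  proof (rule integral_dominated_convergence[where w="\<lambda>_. 1"])
    show "AE x in \<rho>. (\<lambda>n. complex_of_real (exp (- ((real n * (y + x))\<^sup>2 / 2)))) \<longlonglongrightarrow> of_real (indicator {- y} x)"
    proof (rule AE_I2)
      fix x
      show "(\<lambda>n. complex_of_real (exp (- ((real n * (y + x))\<^sup>2 / 2)))) \<longlonglongrightarrow> of_real (indicator {- y} x)"
      proof (cases "x = - y")
        case False
        then have "(y + x)\<^sup>2 > 0" by (simp add: add_eq_0_iff)
        then have "(\<lambda>n. exp (- ((real n)\<^sup>2 * (y + x)\<^sup>2 / 2))) \<longlonglongrightarrow> 0" by real_asymp
        then have "(\<lambda>n. complex_of_real (exp (- ((real n * (y + x))\<^sup>2 / 2)))) \<longlonglongrightarrow> of_real 0"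
          by (intro tendsto_of_real) (simp add: power_mult_distrib)
        with False show ?thesis by simp
      qed simp
    qed
  qed auto
  moreover have "(CLINT x|\<rho>. of_real (indicator {- y} x)) = complex_of_real (measure \<rho> {- y})"
    by (subst integral_complex_of_real) simp
  ultimately show ?thesis by simp
qed

text \<open>The Gaussian means of \<open>\<bar>V\<bar>\<^sup>2 \<cdot> char \<nu>\<close> converge to a weighted sum of atoms of \<open>\<nu>\<close>;
  all of these atoms lie in \<open>G\<close>, and no weight exceeds the one at the origin.\<close>

lemma measure_ge_of_trig_poly_bound:
  fixes l :: "'i \<Rightarrow> real" and I :: "'i set"
  defines "V \<equiv> \<lambda>t. \<Sum>i\<in>I. iexp (t * l i)"
    and "Q \<equiv> card {(i, j) \<in> I \<times> I. l i = l j}"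
  assumes \<nu>: "real_distribution \<nu>" and I: "finite I"
    and G: "G \<in> sets borel" "\<And>i j. i \<in> I \<Longrightarrow> j \<in> I \<Longrightarrow> l i - l j \<in> G"
    and bound: "\<And>t. Re (char \<nu> t) * (cmod (V t))\<^sup>2 \<ge> c * (cmod (V t))\<^sup>2 - e"
  shows "c * real Q - e \<le> real Q * measure \<nu> G"
proof -
  interpret \<nu>: real_distribution \<nu> by fact
  interpret N: real_distribution std_normal_distribution by (rule real_dist_normal_dist)
  \<comment> \<open>The squared modulus is a trigonometric polynomial whose frequencies are the
    differences \<open>l i - l j\<close>.\<close>
  have V2: "of_real ((cmod (V t))\<^sup>2) = (\<Sum>(i, j)\<in>I \<times> I. iexp (t * (l i - l j)))" for t
    unfolding complex_norm_square V_def
    by (simp add: sum_product sum.cartesian_product exp_cnj exp_add[symmetric] algebra_simps)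
  have V_meas [measurable]: "V \<in> borel_measurable borel"
    unfolding V_def by measurable
  have V_le: "cmod (V t) \<le> card I" for t
    unfolding V_def by (rule order.trans[OF norm_sum]) (simp del: of_real_mult)
  have V2_le: "(cmod (V t))\<^sup>2 \<le> (card I)\<^sup>2" for t
    using power_mono[OF V_le[of t] norm_ge_zero, of 2] by simp
  have int1: "integrable std_normal_distribution (\<lambda>s. (cmod (V (real n * s)))\<^sup>2)" for n
    using V2_le by (intro N.integrable_const_bound[where B="(card I)\<^sup>2"]) auto
  \<comment> \<open>The extra frequency \<open>d\<close> serves the point mass at 0 below, for which
    the limit counts the pairs with difference \<open>d\<close>; for \<open>\<nu>\<close> it is set
    to 0.\<close>
  have mean: "(\<lambda>n. gauss_mean n (\<lambda>t. iexp (t * d) * (char \<rho> t * of_real ((cmod (V t))\<^sup>2))))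
      \<longlonglongrightarrow> of_real (\<Sum>(i, j)\<in>I \<times> I. measure \<rho> {l j - l i - d})" if \<rho>: "real_distribution \<rho>" for \<rho> d
  proof -
    interpret \<rho>: real_distribution \<rho> by fact
    have "gauss_mean n (\<lambda>t. iexp (t * d) * (char \<rho> t * of_real ((cmod (V t))\<^sup>2)))
        = (\<Sum>(i, j)\<in>I \<times> I. gauss_mean n (\<lambda>t. iexp (t * (d + (l i - l j))) * char \<rho> t))" for n
    proof -
      have "integrable std_normal_distribution (\<lambda>s. iexp (real n * s * u) * char \<rho> (real n * s))" for u
        by (rule N.integrable_const_bound[where B=1])
          (auto simp: norm_mult \<rho>.cmod_char_le_1 simp del: of_real_mult)
      then have "(\<Sum>(i, j)\<in>I \<times> I. gauss_mean n (\<lambda>t. iexp (t * (d + (l i - l j))) * char \<rho> t))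
          = (CLINT s|std_normal_distribution. (\<Sum>(i, j)\<in>I \<times> I.
               iexp (real n * s * (d + (l i - l j))) * char \<rho> (real n * s)))"
        unfolding case_prod_beta by (intro Bochner_Integration.integral_sum[symmetric])
      also have "\<dots> = gauss_mean n (\<lambda>t. iexp (t * d) * (char \<rho> t * of_real ((cmod (V t))\<^sup>2)))"
        unfolding V2 by (simp add: sum_distrib_left case_prod_beta distrib_left exp_add mult_ac)
      finally show ?thesis by simp
    qed
    moreover have "(\<lambda>n. \<Sum>(i, j)\<in>I \<times> I. gauss_mean n (\<lambda>t. iexp (t * (d + (l i - l j))) * char \<rho> t))
        \<longlonglongrightarrow> (\<Sum>(i, j)\<in>I \<times> I. of_real (measure \<rho> {- (d + (l i - l j))}))"
      unfolding case_prod_beta by (intro tendsto_sum gauss_mean_char_tendsto \<rho>)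
    moreover have "- (d + (l i - l j)) = l j - l i - d" for i j by simp
    ultimately show ?thesis
      by (simp add: case_prod_beta)
  qed
  have R: "real_distribution (return borel (0::real))"
    by (simp add: real_distribution_iff_prob_space_borel prob_space_return)
  define r where "r d = card {(i, j) \<in> I \<times> I. l j - l i = d}" for d
  have r0: "r 0 = Q"
    unfolding r_def Q_def by (intro arg_cong[where f=card]) auto
  have mean_return: "(\<lambda>n. gauss_mean n (\<lambda>t. iexp (t * d) * of_real ((cmod (V t))\<^sup>2))) \<longlonglongrightarrow> of_nat (r d)" for d
  proof -
    have "(\<Sum>(i, j)\<in>I \<times> I. measure (return borel (0::real)) {l j - l i - d})
        = (\<Sum>p\<in>I \<times> I. if l (snd p) - l (fst p) = d then 1 else 0)"
      by (intro sum.cong) (auto simp: measure_return indicator_def)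
    also have "\<dots> = real (r d)"
      unfolding r_def using I by (subst sum.If_cases) (auto intro!: arg_cong[where f=card])
    finally show ?thesis using mean[OF R, of d] by (simp add: char_return)
  qed
  \<comment> \<open>A unimodular factor cannot increase the modulus of the mean of a nonnegative
    function, so the count is largest for the difference 0.\<close>
  have rQ: "r d \<le> Q" for d
  proof -
    have "cmod (gauss_mean n (\<lambda>t. iexp (t * d) * of_real ((cmod (V t))\<^sup>2)))
        \<le> cmod (gauss_mean n (\<lambda>t. iexp (t * 0) * of_real ((cmod (V t))\<^sup>2)))" for n
    proof -
      have "cmod (gauss_mean n (\<lambda>t. iexp (t * d) * of_real ((cmod (V t))\<^sup>2)))
         \<le> (\<integral>s. cmod (iexp (real n * s * d) * of_real ((cmod (V (real n * s)))\<^sup>2)) \<partial>std_normal_distribution)"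
        by (rule integral_norm_bound)
      also have "\<dots> = (\<integral>s. (cmod (V (real n * s)))\<^sup>2 \<partial>std_normal_distribution)"
        by (simp add: norm_mult norm_power del: of_real_mult)
      also have "\<dots> = cmod (gauss_mean n (\<lambda>t. iexp (t * 0) * of_real ((cmod (V t))\<^sup>2)))"
        by (simp del: of_real_power)
      finally show ?thesis .
    qed
    then have "cmod (of_nat (r d)) \<le> cmod (of_nat (r 0))"
      by (intro LIMSEQ_le[OF tendsto_norm[OF mean_return] tendsto_norm[OF mean_return]]) auto
    then show ?thesis by (simp add: r0)
  qed
  \<comment> \<open>Pairs with equal difference share an atom, so the double sum becomes a sum over
    distinct atoms with weights \<open>r d\<close>.\<close>
  have fibre: "(\<Sum>p | p \<in> I \<times> I \<and> (case p of (i, j) \<Rightarrow> l j - l i) = d. case p of (i, j) \<Rightarrow> measure \<nu> {l j - l i})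
      = real (r d) * measure \<nu> {d}" for d
  proof -
    have "(\<Sum>p | p \<in> I \<times> I \<and> (case p of (i, j) \<Rightarrow> l j - l i) = d. case p of (i, j) \<Rightarrow> measure \<nu> {l j - l i})
        = (\<Sum>p | p \<in> I \<times> I \<and> (case p of (i, j) \<Rightarrow> l j - l i) = d. measure \<nu> {d})"
      by (intro sum.cong) auto
    moreover have "{p. p \<in> I \<times> I \<and> (case p of (i, j) \<Rightarrow> l j - l i) = d} = {(i, j) \<in> I \<times> I. l j - l i = d}"
      by auto
    ultimately show ?thesis by (simp add: r_def)
  qed
  have "c * real Q - e \<le> (\<Sum>(i, j)\<in>I \<times> I. measure \<nu> {l j - l i})"
  proof (rule LIMSEQ_le)
    show "(\<lambda>n. c * Re (gauss_mean n (\<lambda>t. of_real ((cmod (V t))\<^sup>2))) - e) \<longlonglongrightarrow> c * real Q - e"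
      using tendsto_Re[OF mean_return[of 0]] r0 by (intro tendsto_intros) simp
    show "(\<lambda>n. Re (gauss_mean n (\<lambda>t. char \<nu> t * of_real ((cmod (V t))\<^sup>2))))
        \<longlonglongrightarrow> (\<Sum>(i, j)\<in>I \<times> I. measure \<nu> {l j - l i})"
      using tendsto_Re[OF mean[OF \<nu>, of 0]] by simp
    have "c * Re (gauss_mean n (\<lambda>t. of_real ((cmod (V t))\<^sup>2))) - e
        \<le> Re (gauss_mean n (\<lambda>t. char \<nu> t * of_real ((cmod (V t))\<^sup>2)))" for n
    proof -
      have int2: "integrable std_normal_distribution
          (\<lambda>s. char \<nu> (real n * s) * of_real ((cmod (V (real n * s)))\<^sup>2))"
        using mult_mono[OF \<nu>.cmod_char_le_1 V2_le]
        by (intro N.integrable_const_bound[where B="(card I)\<^sup>2"]) (auto simp: norm_mult norm_power)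
      have "c * Re (gauss_mean n (\<lambda>t. of_real ((cmod (V t))\<^sup>2))) - e
          = (\<integral>s. c * (cmod (V (real n * s)))\<^sup>2 - e \<partial>std_normal_distribution)"
        using int1[of n] by (simp add: N.prob_space[simplified] del: of_real_power)
      also have "\<dots> \<le> (\<integral>s. Re (char \<nu> (real n * s) * of_real ((cmod (V (real n * s)))\<^sup>2)) \<partial>std_normal_distribution)"
        using int1[of n] int2 bound
        by (intro integral_mono integrable_Re) (auto simp del: of_real_power)
      also have "\<dots> = Re (gauss_mean n (\<lambda>t. char \<nu> t * of_real ((cmod (V t))\<^sup>2)))"
        by (rule integral_Re[OF int2])
      finally show ?thesis .
    qed
    then show "\<exists>N. \<forall>n\<ge>N. c * Re (gauss_mean n (\<lambda>t. of_real ((cmod (V t))\<^sup>2))) - e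
        \<le> Re (gauss_mean n (\<lambda>t. char \<nu> t * of_real ((cmod (V t))\<^sup>2)))" by blast
  qed
  also have "\<dots> = (\<Sum>d\<in>(\<lambda>(i, j). l j - l i) ` (I \<times> I). real (r d) * measure \<nu> {d})"
    using I by (subst sum.image_gen[where g="\<lambda>(i, j). l j - l i"]) (auto intro!: sum.cong fibre)
  also have "\<dots> \<le> (\<Sum>d\<in>(\<lambda>(i, j). l j - l i) ` (I \<times> I). real Q * measure \<nu> {d})"
    using rQ by (intro sum_mono mult_right_mono) auto
  also have "\<dots> = real Q * measure \<nu> ((\<lambda>(i, j). l j - l i) ` (I \<times> I))"
    using I by (subst \<nu>.finite_measure_eq_sum_singleton) (auto simp: sum_distrib_left)
  also have "\<dots> \<le> real Q * measure \<nu> G"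
    using G by (intro mult_left_mono \<nu>.finite_measure_mono) auto
  finally show ?thesis .
qed

section \<open>Real distributions with lattice-periodic characteristic function\<close>

definition int_vecs :: "(real ^ 'd) set" where
  "int_vecs = {k. \<forall>i. k $ i \<in> \<int>}"

lemma int_vecs_diff: "x \<in> int_vecs \<Longrightarrow> y \<in> int_vecs \<Longrightarrow> x - y \<in> int_vecs"
  and int_vecs_add: "x \<in> int_vecs \<Longrightarrow> y \<in> int_vecs \<Longrightarrow> x + y \<in> int_vecs"
  and int_vecs_0: "0 \<in> int_vecs"
  by (auto simp: int_vecs_def)

lemma countable_int_vecs: "countable (int_vecs :: (real ^ 'd) set)"
proof -
  have "(int_vecs :: (real ^ 'd) set) \<subseteq> range (\<lambda>k :: 'd \<Rightarrow> int. \<chi> i. of_int (k i))"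
  proof
    fix x :: "real ^ 'd" assume "x \<in> int_vecs"
    then have "x = (\<chi> i. of_int \<lfloor>x $ i\<rfloor>)" by (simp add: int_vecs_def vec_eq_iff)
    then show "x \<in> range (\<lambda>k :: 'd \<Rightarrow> int. \<chi> i. of_int (k i))"
      by (rule range_eqI[where x="\<lambda>i. \<lfloor>x $ i\<rfloor>"])
  qed
  then show ?thesis by (rule countable_subset) simp
qed

lemma countable_imp_borel: "countable A \<Longrightarrow> A \<in> sets borel" for A :: "'a::t1_space set"
  by (rule sets.countable) simp_all

lemma cmod_one_plus_iexp: "(cmod (1 + iexp x))\<^sup>2 = 2 + 2 * cos x"
proof -
  have "(cmod (1 + iexp x))\<^sup>2 = (1 + cos x)\<^sup>2 + (sin x)\<^sup>2"
    by (simp add: cmod_power2 Re_exp Im_exp)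
  also have "\<dots> = 1 + 2 * cos x + ((cos x)\<^sup>2 + (sin x)\<^sup>2)"
    by (simp add: power2_eq_square algebra_simps)
  finally show ?thesis by simp
qed

text \<open>Cauchy-Schwarz: the fibre sizes of \<open>l\<close> add up to \<open>card I\<close>, and
  their squares add up to the number of pairs with equal value.\<close>

lemma card_fibre_pairs_ge:
  fixes l :: "'i \<Rightarrow> 'b"
  assumes "finite I"
  shows "(real (card I))\<^sup>2 \<le> real (card {(i, j) \<in> I \<times> I. l i = l j}) * real (card (l ` I))"
proof -
  define m where "m y = {i \<in> I. l i = y}" for y
  have "card I = (\<Sum>y\<in>l ` I. card (m y))"
    using sum.image_gen[OF assms, of "\<lambda>_. 1::nat" l] by (simp add: m_def)
  then have "(real (card I))\<^sup>2 = (\<Sum>y\<in>l ` I. real (card (m y)))\<^sup>2" by simp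
  also have "\<dots> \<le> (\<Sum>y\<in>l ` I. (real (card (m y)))\<^sup>2) * card (l ` I)"
    by (rule sum_squared_le_sum_of_squares)
  also have "(\<Sum>y\<in>l ` I. (real (card (m y)))\<^sup>2) = real (card (\<Union>y\<in>l ` I. m y \<times> m y))"
    using assms by (subst card_UN_disjoint) (auto simp: m_def power2_eq_square)
  also have "(\<Union>y\<in>l ` I. m y \<times> m y) = {(i, j) \<in> I \<times> I. l i = l j}"
    by (auto simp: m_def)
  finally show ?thesis .
qed

text \<open>Closeness to the period lattice is measured by cosines because these are the factors of
  the weight used later. Subtracting the nearest period reduces the claim to continuity at
  0.\<close>

lemma periodic_near_lattice:
  fixes h :: "real ^ 'd \<Rightarrow> complex"
  assumes cont: "isCont h 0" and per: "\<And>z k. k \<in> int_vecs \<Longrightarrow> h (z + (2 * pi) *\<^sub>R k) = h z"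
    and "\<epsilon> > 0"
  obtains \<delta> where "0 < \<delta>" "\<delta> < 2" "\<And>z. \<forall>j. cos (z $ j) > 1 - \<delta> \<Longrightarrow> cmod (h z - h 0) < \<epsilon>"
proof -
  obtain r where r: "r > 0" "\<And>z. norm z < r \<Longrightarrow> cmod (h z - h 0) < \<epsilon>"
    using cont \<open>\<epsilon> > 0\<close> by (auto simp: continuous_at_eps_delta dist_norm)
  \<comment> \<open>Up to \<open>pi\<close> the cosine is decreasing; the division by the dimension
    makes the moduli of the coordinates add up to less than \<open>r\<close>.\<close>
  define s where "s = min pi (r / CARD('d))"
  have s: "0 < s" "s \<le> pi" using r by (auto simp: s_def)
  then have "cos s < 1"
    using cos_monotone_0_pi[of 0 s] by simp
  show ?thesis
  proof
    \<comment> \<open>Halving keeps \<open>\<delta>\<close> below 2 even when \<open>s = pi\<close>,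
      and the threshold \<open>1 - \<delta>\<close> still exceeds \<open>cos s\<close>.\<close>
    show "0 < (1 - cos s) / 2" "(1 - cos s) / 2 < 2"
      using \<open>cos s < 1\<close> cos_ge_minus_one[of s] by (auto simp del: cos_ge_minus_one)
    fix z :: "real ^ 'd" assume z: "\<forall>j. cos (z $ j) > 1 - (1 - cos s) / 2"
    \<comment> \<open>\<open>k\<close> is an integer vector nearest to \<open>z / (2 * pi)\<close>,
      so the coordinates of \<open>y\<close> have modulus at most \<open>pi\<close>.\<close>
    define k :: "real ^ 'd" where "k = (\<chi> j. of_int (round (z $ j / (2 * pi))))"
    define y where "y = z - (2 * pi) *\<^sub>R k"
    have k: "- k \<in> int_vecs" by (simp add: k_def int_vecs_def)
    have "\<bar>y $ j\<bar> < s" for j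
    proof -
      have "\<bar>of_int (round (z $ j / (2 * pi))) - z $ j / (2 * pi)\<bar> \<le> 1 / 2"
        by (rule of_int_round_abs_le)
      then have "2 * pi * \<bar>of_int (round (z $ j / (2 * pi))) - z $ j / (2 * pi)\<bar> \<le> pi"
        by simp
      also have "2 * pi * \<bar>of_int (round (z $ j / (2 * pi))) - z $ j / (2 * pi)\<bar> = \<bar>y $ j\<bar>"
      proof -
        have "y $ j = - (2 * pi * (of_int (round (z $ j / (2 * pi))) - z $ j / (2 * pi)))"
          by (simp add: y_def k_def field_simps)
        then show ?thesis by (simp only: abs_minus abs_mult) simp
      qed
      finally have le: "\<bar>y $ j\<bar> \<le> pi" .
      have "cos \<bar>y $ j\<bar> = cos (z $ j)"
        using cos_int_2pin[of "round (z $ j / (2 * pi))"] sin_int_2pin[of "round (z $ j / (2 * pi))"]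
        by (simp add: y_def k_def cos_diff)
      then have "cos s < cos \<bar>y $ j\<bar>"
        using spec[OF z, of j] \<open>cos s < 1\<close> by (simp add: field_simps)
      then show ?thesis
        using le s cos_monotone_0_pi_le[of s "\<bar>y $ j\<bar>"] by force
    qed
    then have "norm y < r"
    proof -
      have "norm y \<le> (\<Sum>j\<in>UNIV. \<bar>y $ j\<bar>)" by (rule norm_le_l1_cart)
      also have "\<dots> < (\<Sum>j\<in>(UNIV::'d set). s)"
        using \<open>\<And>j. \<bar>y $ j\<bar> < s\<close> by (intro sum_strict_mono) auto
      also have "\<dots> \<le> r" by (simp add: s_def min_def field_simps)
      finally show ?thesis .
    qed
    then have "cmod (h y - h 0) < \<epsilon>" by (rule r)
    also have "h y = h z" using per[OF k, of z] by (simp add: y_def)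
    finally show "cmod (h z - h 0) < \<epsilon>" .
  qed
qed

text \<open>With \<open>V t = \<Prod>\<^sub>j (1 + exp (\<i> t a\<^sub>j))\<^sup>p\<close>, the weight \<open>\<bar>V\<bar>\<^sup>2\<close> concentrates for large \<open>p\<close> on the times at
  which \<open>t a\<close> is close to the lattice \<open>2 \<pi> \<int>\<^sup>d\<close>, where \<open>h\<close> is close to 1.\<close>

lemma measure_lattice_image_ge:
  fixes h :: "real ^ 'd \<Rightarrow> complex" and a :: "real ^ 'd"
  assumes \<nu>: "real_distribution \<nu>" and char: "\<And>t. char \<nu> t = h (t *\<^sub>R a)"
    and \<delta>: "0 < \<delta>" "\<delta> < 2" "\<And>z. \<forall>j. cos (z $ j) > 1 - \<delta> \<Longrightarrow> cmod (h z - 1) < \<epsilon>"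
  shows "1 - \<epsilon> - 2 * (1 - \<delta> / 2) ^ p * (real p + 1) ^ CARD('d) \<le> measure \<nu> ((\<bullet>) a ` int_vecs)"
proof -
  interpret real_distribution \<nu> by fact
  \<comment> \<open>The product is expanded over \<open>p\<close> copies of each coordinate: a
    subset of \<open>A\<close> selects the factors that contribute their exponential, and
    \<open>l\<close> is the resulting frequency.\<close>
  define A where "A = {..<p} \<times> (UNIV :: 'd set)"
  define l where "l B = (\<Sum>x\<in>B. a $ snd x)" for B :: "(nat \<times> 'd) set"
  define V where "V t = (\<Sum>B\<in>Pow A. iexp (t * l B))" for t
  define Q where "Q = card {(B, C) \<in> Pow A \<times> Pow A. l B = l C}"
  define N where "N = card A"
  have A: "finite A" and N: "N = p * CARD('d)" by (auto simp: A_def N_def card_cartesian_product)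
  have finB: "finite B" if "B \<in> Pow A" for B using that A finite_subset by blast
  define count where "count B = (\<lambda>j. card {i. (i, j) \<in> B})" for B :: "(nat \<times> 'd) set"
  have l: "l B = (\<Sum>j\<in>UNIV. a $ j * real (count B j))" if "B \<in> Pow A" for B
  proof -
    have "l B = (\<Sum>j\<in>UNIV. \<Sum>x | x \<in> B \<and> snd x = j. a $ snd x)"
      unfolding l_def using finB[OF that] by (subst sum.group) auto
    also have "\<dots> = (\<Sum>j\<in>UNIV. a $ j * real (count B j))"
    proof (rule sum.cong)
      fix j
      have "{x. x \<in> B \<and> snd x = j} = (\<lambda>i. (i, j)) ` {i. (i, j) \<in> B}" by force
      then have "card {x. x \<in> B \<and> snd x = j} = count B j"
        by (simp add: count_def card_image inj_on_def)
      then show "(\<Sum>x | x \<in> B \<and> snd x = j. a $ snd x) = a $ j * real (count B j)" by simp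
    qed simp
    finally show ?thesis .
  qed
  have count_le: "count B j \<le> p" if "B \<in> Pow A" for B j
    using card_mono[of "{..<p}" "{i. (i, j) \<in> B}"] that by (auto simp: count_def A_def)
  \<comment> \<open>The frequency depends only on how many copies of each coordinate are selected,
    so there are only polynomially many frequencies in \<open>p\<close>.\<close>
  have "l ` Pow A \<subseteq> (\<lambda>f. \<Sum>j\<in>UNIV. a $ j * real (f j)) ` (UNIV \<rightarrow>\<^sub>E {..p})"
    using l count_le by auto
  then have "card (l ` Pow A) \<le> card ((UNIV :: 'd set) \<rightarrow>\<^sub>E {..p})"
    by (intro surj_card_le) (auto intro: finite_PiE)
  then have "card (l ` Pow A) \<le> (p + 1) ^ CARD('d)"
    by (simp add: card_PiE)
  then have "real (card (l ` Pow A)) \<le> real ((p + 1) ^ CARD('d))"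
    by (rule of_nat_mono)
  then have cardl: "real (card (l ` Pow A)) \<le> (real p + 1) ^ CARD('d)"
    by (simp add: add.commute)
  \<comment> \<open>Few frequencies for \<open>2 ^ N\<close> subsets force many coincidences:
    \<open>Q\<close> is at least \<open>4 ^ N\<close> up to a polynomial factor.\<close>
  have "4 ^ N = (real (card (Pow A)))\<^sup>2"
    using A by (simp add: card_Pow N_def power2_eq_square flip: power_mult_distrib)
  also have "\<dots> \<le> real Q * real (card (l ` Pow A))"
    unfolding Q_def by (rule card_fibre_pairs_ge) (use A in simp)
  also have "\<dots> \<le> real Q * (real p + 1) ^ CARD('d)"
    using cardl by (intro mult_left_mono) auto
  finally have Q: "4 ^ N \<le> real Q * (real p + 1) ^ CARD('d)" .
  then have "0 < real Q * (real p + 1) ^ CARD('d)"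
    by (rule less_le_trans[rotated]) simp
  then have Q0: "real Q > 0"
    by (simp add: zero_less_mult_iff)
  have "V t = (\<Prod>x\<in>A. 1 + iexp (t * a $ snd x))" for t
  proof -
    have "(\<Prod>x\<in>A. iexp (t * a $ snd x) + 1) = (\<Sum>B\<in>Pow A. (\<Prod>x\<in>B. iexp (t * a $ snd x)) * (\<Prod>x\<in>A - B. 1))"
      using A by (rule prod_add)
    also have "\<dots> = V t"
      unfolding V_def l_def using finB
      by (intro sum.cong) (auto simp: exp_sum[symmetric] sum_distrib_left)
    finally show ?thesis by (simp add: add.commute)
  qed
  also have "(\<Prod>x\<in>A. 1 + iexp (t * a $ snd x)) = (\<Prod>j\<in>UNIV. 1 + iexp (t * a $ j)) ^ p" for t
  proof -
    have "(\<Prod>x\<in>A. 1 + iexp (t * a $ snd x)) = (\<Prod>i<p. \<Prod>j\<in>UNIV. 1 + iexp (t * a $ j))"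
      unfolding A_def by (simp only: prod.cartesian_product case_prod_unfold)
    then show ?thesis by simp
  qed
  finally have V: "V t = (\<Prod>j\<in>UNIV. 1 + iexp (t * a $ j)) ^ p" for t .
  have V2: "(cmod (V t))\<^sup>2 = (\<Prod>j\<in>UNIV. 2 + 2 * cos (t * a $ j)) ^ p" for t
  proof -
    have "(cmod (V t))\<^sup>2 = ((cmod (\<Prod>j\<in>UNIV. 1 + iexp (t * a $ j)))\<^sup>2) ^ p"
      by (simp add: V norm_power mult.commute flip: power_mult)
    also have "(cmod (\<Prod>j\<in>UNIV. 1 + iexp (t * a $ j)))\<^sup>2 = (\<Prod>j\<in>UNIV. (cmod (1 + iexp (t * a $ j)))\<^sup>2)"
      by (simp only: prod_norm[symmetric] prod_power_distrib)
    finally show ?thesis by (simp only: cmod_one_plus_iexp)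
  qed
  \<comment> \<open>The general bound is applied with \<open>c = 1 - \<epsilon>\<close>; its error
    \<open>e\<close> is twice a bound for the weight at times far from the lattice.\<close>
  have "(1 - \<epsilon>) * real Q - 2 * (4 ^ N * (1 - \<delta> / 2) ^ p) \<le> real Q * measure \<nu> ((\<bullet>) a ` int_vecs)"
    unfolding Q_def
  proof (rule measure_ge_of_trig_poly_bound[OF \<nu>])
    show "finite (Pow A)" using A by simp
    show "(\<bullet>) a ` int_vecs \<in> sets borel"
      by (intro countable_imp_borel countable_image countable_int_vecs)
    fix B C assume BC: "B \<in> Pow A" "C \<in> Pow A"
    have "l B - l C = a \<bullet> (\<chi> j. real (count B j) - real (count C j))"
      by (simp add: l[OF BC(1)] l[OF BC(2)] inner_vec_def right_diff_distrib sum_subtractf)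
    moreover have "(\<chi> j. real (count B j) - real (count C j)) \<in> int_vecs"
      by (simp add: int_vecs_def)
    ultimately show "l B - l C \<in> (\<bullet>) a ` int_vecs" by blast
  next
    fix t
    have "(1 - \<epsilon>) * (cmod (V t))\<^sup>2 - 2 * (4 ^ N * (1 - \<delta> / 2) ^ p) \<le> Re (char \<nu> t) * (cmod (V t))\<^sup>2"
    proof (cases "\<forall>j. cos (t * a $ j) > 1 - \<delta>")
      case True
      then have "cmod (char \<nu> t - 1) < \<epsilon>"
        unfolding char by (intro \<delta>) simp
      then have "1 - \<epsilon> \<le> Re (char \<nu> t)"
        using abs_Re_le_cmod[of "char \<nu> t - 1"] by simp
      then have "(1 - \<epsilon>) * (cmod (V t))\<^sup>2 \<le> Re (char \<nu> t) * (cmod (V t))\<^sup>2"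
        by (intro mult_right_mono) auto
      moreover have "0 \<le> 2 * (4 ^ N * (1 - \<delta> / 2) ^ p)" using \<delta> by simp
      ultimately show ?thesis by linarith
    next
      case False
      then obtain j where j: "cos (t * a $ j) \<le> 1 - \<delta>" by (meson not_le)
      have "\<epsilon> > 0"
        using \<delta>(3)[of 0] \<delta>(1) by (simp add: le_less_trans[OF norm_ge_zero])
      have nonneg: "0 \<le> 2 + 2 * cos x" for x :: real
        using cos_ge_minus_one[of x] by linarith
      have "(\<Prod>i\<in>UNIV. 2 + 2 * cos (t * a $ i)) = (2 + 2 * cos (t * a $ j)) * (\<Prod>i\<in>UNIV - {j}. 2 + 2 * cos (t * a $ i))"
        by (rule prod.remove) auto
      also have "\<dots> \<le> (4 * (1 - \<delta> / 2)) * (\<Prod>i\<in>UNIV - {j}. 4)"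
      proof (rule mult_mono)
        show "2 + 2 * cos (t * a $ j) \<le> 4 * (1 - \<delta> / 2)" using j by simp
        show "(\<Prod>i\<in>UNIV - {j}. 2 + 2 * cos (t * a $ i)) \<le> (\<Prod>i\<in>UNIV - {j}. 4)"
          by (rule prod_mono) (use nonneg in simp)
        show "0 \<le> (\<Prod>i\<in>UNIV - {j}. 2 + 2 * cos (t * a $ i))"
          by (rule prod_nonneg) (use nonneg in simp)
      qed (use \<delta>(2) in simp)
      also have "\<dots> = 4 ^ CARD('d) * (1 - \<delta> / 2)"
        by (simp add: card_Diff_singleton power_eq_if[of _ "CARD('d)"] algebra_simps)
      finally have "(cmod (V t))\<^sup>2 \<le> (4 ^ CARD('d) * (1 - \<delta> / 2)) ^ p"
        unfolding V2 using nonneg by (intro power_mono prod_nonneg) auto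
      also have "\<dots> = 4 ^ N * (1 - \<delta> / 2) ^ p"
        by (simp add: N power_mult_distrib mult.commute flip: power_mult)
      finally have le: "(cmod (V t))\<^sup>2 \<le> 4 ^ N * (1 - \<delta> / 2) ^ p" .
      \<comment> \<open>Far from the lattice only this trivial bound is available. It falls short of
        \<open>1 - \<epsilon>\<close> by at most 2, whence the factor 2 in the error.\<close>
      have "-1 \<le> Re (char \<nu> t)"
        using cmod_char_le_1[of t] abs_Re_le_cmod[of "char \<nu> t"] by linarith
      then have "(1 - \<epsilon> - 2) * (cmod (V t))\<^sup>2 \<le> Re (char \<nu> t) * (cmod (V t))\<^sup>2"
        using \<open>\<epsilon> > 0\<close> by (intro mult_right_mono) auto
      with le show ?thesis by (simp add: algebra_simps)
    qed
    then show "(1 - \<epsilon>) * (cmod (\<Sum>B\<in>Pow A. iexp (t * l B)))\<^sup>2 - 2 * (4 ^ N * (1 - \<delta> / 2) ^ p)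
        \<le> Re (char \<nu> t) * (cmod (\<Sum>B\<in>Pow A. iexp (t * l B)))\<^sup>2"
      unfolding V_def .
  qed
  moreover have "2 * (4 ^ N * (1 - \<delta> / 2) ^ p) \<le> real Q * (2 * (1 - \<delta> / 2) ^ p * (real p + 1) ^ CARD('d))"
    using mult_right_mono[OF Q, of "2 * (1 - \<delta> / 2) ^ p"] \<delta> by (simp add: mult_ac)
  ultimately have "real Q * (1 - \<epsilon> - 2 * (1 - \<delta> / 2) ^ p * (real p + 1) ^ CARD('d))
      \<le> real Q * measure \<nu> ((\<bullet>) a ` int_vecs)"
    by (simp add: algebra_simps)
  then show ?thesis using Q0 by simp
qed

text \<open>The error in the preceding estimate decays geometrically in \<open>p\<close> against
  polynomial growth; letting \<open>p\<close> tend to infinity and then \<open>\<epsilon>\<close> to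
  0 gives full measure.\<close>

lemma AE_lattice_image:
  fixes h :: "real ^ 'd \<Rightarrow> complex" and a :: "real ^ 'd"
  assumes \<nu>: "real_distribution \<nu>" and char: "\<And>t. char \<nu> t = h (t *\<^sub>R a)"
    and cont: "isCont h 0" and per: "\<And>z k. k \<in> int_vecs \<Longrightarrow> h (z + (2 * pi) *\<^sub>R k) = h z"
  shows "AE x in \<nu>. x \<in> (\<bullet>) a ` int_vecs"
proof -
  interpret real_distribution \<nu> by fact
  have h0: "h 0 = 1" using char[of 0] by (simp add: char_zero)
  have "1 - \<epsilon> \<le> measure \<nu> ((\<bullet>) a ` int_vecs)" if "\<epsilon> > 0" for \<epsilon>
  proof (rule periodic_near_lattice[OF cont per that])
    fix \<delta> assume \<delta>: "0 < \<delta>" "\<delta> < 2" "\<And>z. \<forall>j. cos (z $ j) > 1 - \<delta> \<Longrightarrow> cmod (h z - h 0) < \<epsilon>"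
    define q where "q = 1 - \<delta> / 2"
    have "0 < q" "q < 1" using \<delta> by (auto simp: q_def)
    then have lim: "(\<lambda>p. q ^ p * (real p + 1) ^ m) \<longlonglongrightarrow> 0" for m
      by real_asymp
    have "(\<lambda>p. 1 - \<epsilon> - 2 * (q ^ p * (real p + 1) ^ CARD('d))) \<longlonglongrightarrow> 1 - \<epsilon> - 2 * 0"
      by (intro tendsto_diff tendsto_mult tendsto_const lim)
    then have "1 - \<epsilon> - 2 * 0 \<le> measure \<nu> ((\<bullet>) a ` int_vecs)"
    proof (rule LIMSEQ_le_const2, intro exI allI impI)
      fix p :: nat
      have "1 - \<epsilon> - 2 * (1 - \<delta> / 2) ^ p * (real p + 1) ^ CARD('d) \<le> measure \<nu> ((\<bullet>) a ` int_vecs)"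
        by (rule measure_lattice_image_ge[OF \<nu> char \<delta>(1,2)]) (erule \<delta>(3)[unfolded h0])
      then show "1 - \<epsilon> - 2 * (q ^ p * (real p + 1) ^ CARD('d)) \<le> measure \<nu> ((\<bullet>) a ` int_vecs)"
        by (simp only: q_def mult.assoc)
    qed
    then show "1 - \<epsilon> \<le> measure \<nu> ((\<bullet>) a ` int_vecs)" by simp
  qed
  then have "1 - prob ((\<bullet>) a ` int_vecs) \<le> 0 + \<epsilon>" if "\<epsilon> > 0" for \<epsilon>
    using that by (simp add: algebra_simps)
  then have "1 - prob ((\<bullet>) a ` int_vecs) \<le> 0"
    by (rule field_le_epsilon)
  then have "prob ((\<bullet>) a ` int_vecs) = 1"
    using prob_le_1[of "(\<bullet>) a ` int_vecs"] by linarith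
  then show ?thesis
    by (rule AE_prob_1)
qed

section \<open>One rationally independent direction suffices\<close>

lemma char_distr_inner:
  fixes \<mu> :: "(real ^ 'd) measure"
  assumes [measurable_cong]: "sets \<mu> = sets borel"
  shows "char (distr \<mu> borel ((\<bullet>) a)) t = char_vec \<mu> (t *\<^sub>R a)"
  unfolding char_vec_def by (subst char_distr) auto

lemma real_distribution_distr_inner:
  fixes \<mu> :: "(real ^ 'd) measure"
  assumes "prob_space \<mu>" and [measurable_cong]: "sets \<mu> = sets borel"
  shows "real_distribution (distr \<mu> borel ((\<bullet>) a))"
  by (rule prob_space.real_distribution_distr[OF assms(1)]) measurable

lemma isCont_char_vec:
  fixes \<mu> :: "(real ^ 'd) measure"
  assumes "prob_space \<mu>" and [measurable_cong]: "sets \<mu> = sets borel"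
  shows "isCont (char_vec \<mu>) z"
  unfolding continuous_at_sequentially
proof safe
  interpret prob_space \<mu> by fact
  fix X assume X: "X \<longlonglongrightarrow> z"
  show "(char_vec \<mu> \<circ> X) \<longlonglongrightarrow> char_vec \<mu> z"
    unfolding comp_def char_vec_def
    by (rule integral_dominated_convergence[where w="\<lambda>_. 1"]) (auto intro!: tendsto_intros X)
qed

lemma inner_int_vecs: "x \<in> int_vecs \<Longrightarrow> y \<in> int_vecs \<Longrightarrow> x \<bullet> y \<in> \<int>"
  by (auto simp: int_vecs_def inner_vec_def intro!: Ints_sum Ints_mult)

lemma char_vec_periodic:
  fixes \<mu> :: "(real ^ 'd) measure"
  assumes [measurable_cong]: "sets \<mu> = sets borel" and lattice: "AE x in \<mu>. x \<in> int_vecs" and k: "k \<in> int_vecs"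
  shows "char_vec \<mu> (z + (2 * pi) *\<^sub>R k) = char_vec \<mu> z"
  unfolding char_vec_def
proof (rule integral_cong_AE)
  show "AE x in \<mu>. iexp ((z + (2 * pi) *\<^sub>R k) \<bullet> x) = iexp (z \<bullet> x)"
    using lattice
  proof eventually_elim
    case (elim x)
    then obtain n where n: "k \<bullet> x = of_int n"
      using inner_int_vecs[OF k] by (auto elim: Ints_cases)
    have "iexp ((z + (2 * pi) *\<^sub>R k) \<bullet> x) = iexp (z \<bullet> x) * exp (2 * of_int n * of_real pi * \<i>)"
      by (simp add: inner_add_left n distrib_left mult_ac flip: exp_add)
    also have "\<dots> = iexp (z \<bullet> x)"
      by (simp add: exp_eq_1)
    finally show ?case .
  qed
qed measurable

text \<open>The difference of two points of a coset is an integer vector, and equal projections make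
  it a rational relation among the coordinates of \<open>a\<close>. Cosets occur because convolution
  roots live on a shifted lattice.\<close>

lemma inj_on_inner_int_vecs:
  assumes "rat_independent_coords a"
  shows "inj_on ((\<bullet>) a) ((+) c ` int_vecs)"
proof (rule inj_onI)
  fix x y assume "x \<in> (+) c ` int_vecs" "y \<in> (+) c ` int_vecs" and eq: "a \<bullet> x = a \<bullet> y"
  then have xy: "x - y \<in> int_vecs"
    by (auto intro: int_vecs_diff)
  define q :: "_ \<Rightarrow> rat" where "q i = of_int \<lfloor>(x - y) $ i\<rfloor>" for i
  have q: "of_rat (q i) = (x - y) $ i" for i
  proof -
    have "of_int \<lfloor>(x - y) $ i\<rfloor> = (x - y) $ i"
    proof -
      have "(x - y) $ i \<in> \<int>" using xy unfolding int_vecs_def by blast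
      then obtain n where "(x - y) $ i = of_int n" by (rule Ints_cases)
      then show ?thesis by (simp only: floor_of_int)
    qed
    then show ?thesis by (simp add: q_def)
  qed
  have "(\<Sum>i\<in>UNIV. of_rat (q i) * a $ i) = a \<bullet> (x - y)"
    by (simp only: q inner_vec_def) (simp add: mult.commute)
  also have "\<dots> = 0" using eq by (simp add: inner_diff_right)
  finally have "\<forall>i. q i = 0" using assms by (simp add: rat_independent_coords_def)
  then have "\<forall>i. (x - y) $ i = 0" using q by (metis of_rat_0)
  then show "x = y" by (simp add: vec_eq_iff)
qed

text \<open>Up to a null set, \<open>A\<close> is the preimage of the image of
  \<open>A \<inter> C\<close>, which is countable and hence Borel. This lets a law on the lattice be
  recovered from one projection.\<close>

lemma measure_eqI_countable_inj:
  fixes M N :: "'a::topological_space measure" and f :: "'a \<Rightarrow> 'b::t1_space"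
  assumes [measurable_cong]: "sets M = sets borel" "sets N = sets borel"
    and M: "AE x in M. x \<in> C" and N: "AE x in N. x \<in> C"
    and C: "countable C" "inj_on f C" and [measurable]: "f \<in> borel_measurable borel"
    and eq: "distr M borel f = distr N borel f"
  shows "M = N"
proof (rule measure_eqI)
  fix A assume "A \<in> sets M"
  then have A [measurable]: "A \<in> sets borel" using assms by simp
  have B [measurable]: "f ` (A \<inter> C) \<in> sets borel"
    using C by (intro countable_imp_borel countable_image countable_Int2)
  have *: "emeasure P A = emeasure (distr P borel f) (f ` (A \<inter> C))"
    if [measurable_cong]: "sets P = sets borel" and P: "AE x in P. x \<in> C" for P :: "'a measure"
  proof -
    have sp: "space P = UNIV" using sets_eq_imp_space_eq[OF that(1)] by simp
    have "emeasure P A = emeasure P (f -` (f ` (A \<inter> C)) \<inter> space P)"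
    proof (rule emeasure_eq_AE)
      show "AE x in P. x \<in> A \<longleftrightarrow> x \<in> f -` (f ` (A \<inter> C)) \<inter> space P"
        using P by eventually_elim (use C in \<open>auto simp: sp inj_on_def\<close>)
    qed (use that in measurable)
    then show ?thesis by (subst emeasure_distr) auto
  qed
  show "emeasure M A = emeasure N A"
    using *[OF assms(1) M] *[OF assms(2) N] eq by simp
qed (simp add: assms)

text \<open>Brings the powers of a root on a shifted lattice back to the lattice itself, once the
  shifts add up to an integer vector.\<close>

lemma AE_conv_power_coset:
  fixes \<rho> :: "(real ^ 'd) measure"
  assumes \<rho>: "prob_space \<rho>" "sets \<rho> = sets borel" and AE: "AE x in \<rho>. x \<in> (+) c ` int_vecs"
  shows "AE x in conv_power k \<rho>. x \<in> (+) (real k *\<^sub>R c) ` int_vecs"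
proof (induction k)
  case 0
  have "(int_vecs :: (real ^ 'd) set) \<in> sets borel"
    by (intro countable_imp_borel countable_int_vecs)
  then have "AE x in return borel (0 :: real ^ 'd). x \<in> int_vecs"
    by (subst AE_return) (auto simp: int_vecs_0)
  then show ?case unfolding conv_power.simps by simp
next
  case (Suc k)
  have "(+) (real (Suc k) *\<^sub>R c) ` int_vecs \<in> sets borel"
    by (intro countable_imp_borel countable_image countable_int_vecs)
  moreover have "x + y \<in> (+) (real (Suc k) *\<^sub>R c) ` int_vecs"
    if xy: "x \<in> (+) c ` int_vecs" "y \<in> (+) (real k *\<^sub>R c) ` int_vecs" for x y
  proof -
    obtain u v where "u \<in> int_vecs" "v \<in> int_vecs" "x = c + u" "y = real k *\<^sub>R c + v"
      using xy by auto
    then show ?thesis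
      by (intro image_eqI[of _ _ "u + v"]) (auto intro: int_vecs_add simp: algebra_simps)
  qed
  ultimately show ?case
    unfolding conv_power.simps
    by (intro AE_convolution[OF _ _ _ _ AE Suc]) (simp_all add: \<rho> prob_space_conv_power sets_conv_power)
qed

text \<open>The values of \<open>f\<close> are integer multiples of \<open>2 * pi * \<i>\<close>, a
  discrete set, and the domain is connected.\<close>

lemma constant_of_exp_eq_1:
  fixes f :: "'a::real_normed_vector \<Rightarrow> complex"
  assumes cont: "continuous_on UNIV f" and exp: "\<And>z. exp (f z) = 1"
  shows "f x = f y"
proof -
  have "f constant_on UNIV"
  proof (rule continuous_discrete_range_constant[OF connected_UNIV cont])
    fix x
    have "2 * pi \<le> cmod (f y - f x)" if "f y \<noteq> f x" for y
    proof (rule ccontr)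
      assume "\<not> 2 * pi \<le> cmod (f y - f x)"
      then have "\<bar>Im (f y) - Im (f x)\<bar> < 2 * pi"
        using abs_Im_le_cmod[of "f y - f x"] by simp
      then have "f y = f x" by (rule exp_complex_eqI) (simp only: exp)
      with that show False by simp
    qed
    then show "\<exists>e>0. \<forall>y. y \<in> UNIV \<and> f y \<noteq> f x \<longrightarrow> e \<le> cmod (f y - f x)"
      by (intro exI[of _ "2 * pi"]) auto
  qed
  then show ?thesis by (auto simp: constant_on_def)
qed

text \<open>Induction in both directions gives integer multiples of axis vectors, then finite sums
  give the lattice. It makes the increments of a logarithm over periods linear.\<close>

lemma additive_int_vecs_expand:
  fixes c :: "real ^ 'd \<Rightarrow> complex"
  assumes add: "\<And>x y. x \<in> int_vecs \<Longrightarrow> y \<in> int_vecs \<Longrightarrow> c (x + y) = c x + c y" and k: "k \<in> int_vecs"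
  shows "c k = (\<Sum>j\<in>UNIV. of_real (k $ j) * c (axis j 1))"
proof -
  have c0: "c 0 = 0" using add[of 0 0] by (simp add: int_vecs_0)
  have axis: "of_int n *\<^sub>R axis j 1 \<in> int_vecs" for j :: 'd and n :: int
    by (simp add: int_vecs_def axis_def)
  have axis1: "axis j 1 \<in> int_vecs" for j :: 'd
    using axis[of 1] by simp
  have c_axis: "c (of_int n *\<^sub>R axis j 1) = of_int n * c (axis j 1)" for j :: 'd and n :: int
  proof (induction n rule: int_induct[where k=0])
    case base then show ?case by (simp add: c0)
  next
    case (step1 i)
    then show ?case using add[OF axis axis1, of i j j] by (simp add: algebra_simps)
  next
    case (step2 i)
    then show ?case using add[OF axis axis1, of "i - 1" j j] by (simp add: algebra_simps)
  qed
  have k_axis: "(k $ j) *\<^sub>R axis j 1 \<in> int_vecs \<and> c ((k $ j) *\<^sub>R axis j 1) = of_real (k $ j) * c (axis j 1)" for j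
  proof -
    obtain n where "k $ j = of_int n" using k by (auto simp: int_vecs_def elim: Ints_cases)
    then show ?thesis using c_axis[of n j] axis[of n j] by simp
  qed
  have *: "(\<Sum>j\<in>S. (k $ j) *\<^sub>R axis j 1) \<in> int_vecs
      \<and> c (\<Sum>j\<in>S. (k $ j) *\<^sub>R axis j 1) = (\<Sum>j\<in>S. of_real (k $ j) * c (axis j 1))" if "finite S" for S
    using that
  proof induction
    case empty then show ?case by (simp add: int_vecs_0 c0)
  next
    case (insert j S)
    then show ?case using k_axis[of j] by (simp add: add int_vecs_add)
  qed
  have "(\<Sum>j\<in>UNIV. (k $ j) *\<^sub>R axis j 1) = k"
    using basis_expansion[of k] by (simp add: scalar_mult_eq_scaleR)
  with *[of UNIV] show ?thesis by simp
qed

text \<open>A root of order \<open>n\<close> of the projection lives on the image of the lattice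
  shifted by \<open>m / n\<close>, where \<open>m\<close> is the integer vector of the linear term.
  There the projection is injective, so the root lifts, and \<open>n\<close> shifts add up to
  \<open>m\<close>.\<close>

lemma infinitely_divisible_if_rat_independent:
  fixes \<mu> :: "(real ^ 'd) measure"
  assumes \<mu>: "prob_space \<mu>" "sets \<mu> = sets borel" and lattice: "AE x in \<mu>. x \<in> int_vecs"
    and nz: "\<And>z. char_vec \<mu> z \<noteq> 0" and a: "rat_independent_coords a"
    and id: "infinitely_divisible (distr \<mu> borel ((\<bullet>) a))"
  shows "infinitely_divisible \<mu>"
  unfolding infinitely_divisible_def
proof (intro allI impI)
  fix n :: nat assume n: "n \<ge> 1"
  obtain \<nu> where \<nu>: "prob_space \<nu>" "sets \<nu> = sets borel" "distr \<mu> borel ((\<bullet>) a) = conv_power n \<nu>"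
    using id n unfolding infinitely_divisible_def by blast
  then interpret \<nu>: real_distribution \<nu>
    using real_distribution_iff_prob_space_borel by blast
  have cont: "continuous_on UNIV (char_vec \<mu>)"
    using isCont_char_vec[OF \<mu>] by (simp add: continuous_on_eq_continuous_at)
  have "contractible (UNIV :: (real ^ 'd) set)" by (simp add: convex_imp_contractible)
  then obtain g where g: "continuous_on UNIV g" "\<And>z. char_vec \<mu> z = exp (g z)"
    using continuous_logarithm_on_contractible[OF cont] nz by (metis UNIV_I)
  have "char_vec \<mu> 0 = 1"
    using prob_space.prob_space[OF \<mu>(1)] by (simp add: char_vec_def)
  \<comment> \<open>The normalization fixes the branch: \<open>exp (g 0 / of_nat n)\<close> may be a
    nontrivial root of unity.\<close>
  define \<psi> where "\<psi> z = g z - g 0" for z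
  have \<psi>_cont [continuous_intros]: "continuous_on S \<psi>" for S
    unfolding \<psi>_def by (intro continuous_intros continuous_on_subset[OF g(1)]) auto
  have \<psi>: "char_vec \<mu> z = exp (\<psi> z)" for z
    using \<open>char_vec \<mu> 0 = 1\<close> by (simp add: \<psi>_def g(2) exp_diff)
  have \<psi>0: "\<psi> 0 = 0" by (simp add: \<psi>_def)
  have root: "char \<nu> t = exp (\<psi> (t *\<^sub>R a) / of_nat n)" for t
  proof -
    \<comment> \<open>The quotient of the two sides is continuous, takes values among the
      \<open>n\<close>-th roots of unity, and equals 1 at 0.\<close>
    define r where "r t = char \<nu> t / exp (\<psi> (t *\<^sub>R a) / of_nat n)" for t
    have "char \<nu> t ^ n = exp (\<psi> (t *\<^sub>R a))" for t
      using char_conv_power[OF \<nu>.real_distribution_axioms, of n t]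
      by (simp add: \<nu>(3)[symmetric] char_distr_inner[OF \<mu>(2)] \<psi>)
    then have rn: "r t ^ n = 1" for t
      using n by (simp add: r_def power_divide flip: exp_of_nat_mult)
    have "continuous_on UNIV (char \<nu>)"
      using \<nu>.isCont_char by (simp add: continuous_at_imp_continuous_on)
    moreover have "continuous_on UNIV (\<lambda>t. \<psi> (t *\<^sub>R a))"
      by (rule continuous_on_compose2[OF \<psi>_cont[of UNIV]]) (auto intro!: continuous_intros)
    ultimately have "continuous_on UNIV r"
      unfolding r_def by (intro continuous_intros) (use n in auto)
    moreover have "finite (range r)"
      by (rule finite_subset[OF _ finite_roots_unity[OF n]]) (auto simp: rn)
    ultimately have "r constant_on UNIV"
      by (intro continuous_finite_range_constant connected_UNIV)
    then have "r t = r 0" by (auto simp: constant_on_def)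
    also have "r 0 = 1" by (simp add: r_def \<nu>.char_zero \<psi>0)
    finally show ?thesis by (simp add: r_def)
  qed
  \<comment> \<open>The increment of the logarithm over a period. It is the same at every base
    point, since it varies continuously and its exponential is 1.\<close>
  define c where "c k = \<psi> ((2 * pi) *\<^sub>R k)" for k
  have c: "\<psi> (z + (2 * pi) *\<^sub>R k) = \<psi> z + c k" and exp_c: "exp (c k) = 1" if k: "k \<in> int_vecs" for z k
  proof -
    define f where "f z = \<psi> (z + (2 * pi) *\<^sub>R k) - \<psi> z" for z
    have "continuous_on UNIV f"
      unfolding f_def
      by (intro continuous_intros continuous_on_compose2[OF \<psi>_cont[of UNIV]]) auto
    moreover have exp_f: "exp (f z) = 1" for z
      using char_vec_periodic[OF \<mu>(2) lattice k, of z] by (simp add: f_def exp_diff \<psi>)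
    ultimately have "f z = f 0" by (rule constant_of_exp_eq_1)
    moreover have "f 0 = c k" by (simp add: f_def c_def \<psi>0)
    ultimately show "\<psi> (z + (2 * pi) *\<^sub>R k) = \<psi> z + c k" "exp (c k) = 1"
      using exp_f[of 0] by (simp_all add: f_def diff_eq_eq add.commute)
  qed
  have c_add: "c (x + y) = c x + c y" if "x \<in> int_vecs" "y \<in> int_vecs" for x y
    using c[OF that(2), of "(2 * pi) *\<^sub>R x"] by (simp add: c_def scaleR_add_right)
  \<comment> \<open>The winding numbers of \<open>char_vec \<mu>\<close> along the coordinate
    directions.\<close>
  define m :: "real ^ 'd" where "m = (\<chi> j. Im (c (axis j 1)) / (2 * pi))"
  have axis: "axis j 1 \<in> int_vecs" for j :: 'd
    by (simp add: int_vecs_def axis_def)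
  have m: "m $ j \<in> \<int> \<and> c (axis j 1) = 2 * pi * \<i> * m $ j" for j
  proof -
    obtain i :: int where "Re (c (axis j 1)) = 0" "Im (c (axis j 1)) = of_int (2 * i) * pi"
      using exp_c[OF axis[of j]] by (auto simp: exp_eq_1)
    then show ?thesis by (simp add: m_def complex_eq_iff)
  qed
  have c_inner: "c k = 2 * pi * \<i> * (m \<bullet> k)" if "k \<in> int_vecs" for k
    using m by (subst additive_int_vecs_expand[OF c_add that])
      (auto simp: inner_vec_def sum_distrib_left mult_ac)
  \<comment> \<open>The linear term is removed before dividing by \<open>n\<close>: the increments
    of \<open>\<psi> / n\<close> are multiples of \<open>2 * pi * \<i> / n\<close>, which the
    exponential need not send to 1.\<close>
  define h where "h z = exp ((\<psi> z - \<i> * (m \<bullet> z)) / of_nat n)" for z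
  \<comment> \<open>Translating \<open>\<nu>\<close> by \<open>- (a \<bullet> b)\<close> multiplies
    its characteristic function by exactly the factor that removes the linear term.\<close>
  define b where "b = (1 / real n) *\<^sub>R m"
  define \<nu>' where "\<nu>' = distr \<nu> borel (\<lambda>x. x - a \<bullet> b)"
  have rd: "real_distribution \<nu>'"
    unfolding \<nu>'_def by (rule \<nu>.real_distribution_distr) measurable
  have "char \<nu>' t = h (t *\<^sub>R a)" for t
  proof -
    have "char \<nu>' t = (CLINT x|\<nu>. iexp (t * x) * iexp (- t * (a \<bullet> b)))"
      unfolding \<nu>'_def by (subst char_distr) (auto simp: right_diff_distrib exp_diff exp_minus divide_inverse)
    also have "\<dots> = char \<nu> t * iexp (- t * (a \<bullet> b))"
      unfolding char_def by simp
    also have "\<dots> = exp (\<psi> (t *\<^sub>R a) / of_nat n + \<i> * of_real (- t * (a \<bullet> b)))"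
      by (simp only: root exp_add)
    also have "\<psi> (t *\<^sub>R a) / of_nat n + \<i> * of_real (- t * (a \<bullet> b))
        = (\<psi> (t *\<^sub>R a) - \<i> * (m \<bullet> (t *\<^sub>R a))) / of_nat n"
      by (simp add: b_def diff_divide_distrib inner_commute[of m])
    also have "exp \<dots> = h (t *\<^sub>R a)"
      by (simp add: h_def)
    finally show ?thesis .
  qed
  moreover have "isCont h 0"
  proof -
    have "continuous_on UNIV h" unfolding h_def using n by (intro continuous_intros) auto
    then show ?thesis by (simp add: continuous_on_eq_continuous_at)
  qed
  moreover have "h (z + (2 * pi) *\<^sub>R k) = h z" if "k \<in> int_vecs" for z k
  proof -
    have "\<psi> (z + (2 * pi) *\<^sub>R k) - \<i> * (m \<bullet> (z + (2 * pi) *\<^sub>R k)) = \<psi> z - \<i> * (m \<bullet> z)"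
      by (simp add: c[OF that] c_inner[OF that] inner_add_right distrib_left)
    then show ?thesis by (simp only: h_def)
  qed
  ultimately have "AE x in \<nu>'. x \<in> (\<bullet>) a ` int_vecs"
    by (rule AE_lattice_image[OF rd])
  define S where "S = (+) b ` int_vecs"
  have S: "countable S" "inj_on ((\<bullet>) a) S"
    by (simp_all add: S_def countable_int_vecs inj_on_inner_int_vecs[OF a])
  have "AE x in \<nu>. x - a \<bullet> b \<in> (\<bullet>) a ` int_vecs"
    using \<open>AE x in \<nu>'. x \<in> (\<bullet>) a ` int_vecs\<close> unfolding \<nu>'_def
    by (subst (asm) AE_distr_iff) (auto intro!: countable_imp_borel[simplified] countable_image countable_int_vecs)
  then have AE_S: "AE x in \<nu>. x \<in> (\<bullet>) a ` S"
  proof eventually_elim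
    case (elim x)
    then obtain k where k: "k \<in> int_vecs" "x - a \<bullet> b = a \<bullet> k" by auto
    then have "x = a \<bullet> (b + k)" by (simp add: inner_add_right)
    with k show ?case by (auto simp: S_def)
  qed
  \<comment> \<open>A right inverse of the projection with values in the shifted lattice. It differs
    from the constant 0 on a countable set only, hence is measurable.\<close>
  define G where "G y = (if y \<in> (\<bullet>) a ` S then inv_into S ((\<bullet>) a) y else 0)" for y
  have [measurable]: "G \<in> borel_measurable borel"
    by (rule measurable_discrete_difference[where f="\<lambda>_. 0" and X="(\<bullet>) a ` S"])
      (auto simp: G_def S(1))
  have G: "G y \<in> S" "a \<bullet> G y = y" if "y \<in> (\<bullet>) a ` S" for y
    using that by (auto simp: G_def inv_into_into f_inv_into_f)
  define \<rho> where "\<rho> = distr \<nu> borel G"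
  have \<rho>: "prob_space \<rho>" "sets \<rho> = sets borel"
    unfolding \<rho>_def by (auto intro!: \<nu>.prob_space_distr)
  have "distr \<rho> borel ((\<bullet>) a) = distr \<nu> borel (\<lambda>y. a \<bullet> G y)"
    unfolding \<rho>_def by (subst distr_distr) (auto simp: comp_def)
  also have "\<dots> = distr \<nu> borel (\<lambda>y. y)"
    by (rule distr_cong_AE) (use AE_S in \<open>auto simp: G\<close>)
  also have "\<dots> = \<nu>" by (simp add: distr_id2)
  finally have push: "distr (conv_power n \<rho>) borel ((\<bullet>) a) = distr \<mu> borel ((\<bullet>) a)"
    by (subst distr_conv_power) (auto simp: \<rho> inner_add_right \<nu>(3))
  have "AE x in \<rho>. x \<in> (+) b ` int_vecs"
    unfolding \<rho>_def
  proof (subst AE_distr_iff)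
    show "AE x in \<nu>. G x \<in> (+) b ` int_vecs"
      using AE_S by eventually_elim (use G in \<open>auto simp: S_def\<close>)
    show "{x \<in> space borel. x \<in> (+) b ` int_vecs} \<in> sets borel"
      using countable_imp_borel[OF S(1)] by (simp add: S_def)
  qed measurable
  then have "AE x in conv_power n \<rho>. x \<in> (+) (real n *\<^sub>R b) ` int_vecs"
    by (rule AE_conv_power_coset[OF \<rho>])
  \<comment> \<open>Here \<open>real n *\<^sub>R b = m\<close>, and the coordinates of
    \<open>m\<close> are integers.\<close>
  then have lattice': "AE x in conv_power n \<rho>. x \<in> int_vecs"
  proof eventually_elim
    case (elim x)
    then obtain k where "k \<in> int_vecs" "x = m + k" using n by (auto simp: b_def)
    moreover have "m \<in> int_vecs" using m by (simp add: int_vecs_def)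
    ultimately show ?case by (simp add: int_vecs_add)
  qed
  have "inj_on ((\<bullet>) a) int_vecs"
    using inj_on_inner_int_vecs[OF a, of 0] by simp
  then have "\<mu> = conv_power n \<rho>"
    by (intro measure_eqI_countable_inj[OF _ _ lattice lattice' countable_int_vecs _ _ push[symmetric]])
      (simp_all add: \<mu> sets_conv_power)
  then show "\<exists>\<rho>. prob_space \<rho> \<and> sets \<rho> = sets borel \<and> \<mu> = conv_power n \<rho>"
    using \<rho> by blast
qed

section \<open>Weak limits of projections\<close>

lemma measure_convolution_ge:
  fixes M N :: "real measure"
  assumes "real_distribution M" "real_distribution N"
    and [measurable]: "A \<in> sets borel" "B \<in> sets borel" "C \<in> sets borel"
    and C: "\<And>x y. x \<in> A \<Longrightarrow> y \<in> B \<Longrightarrow> x + y \<in> C"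
  shows "measure M A * measure N B \<le> measure (convolution M N) C"
proof -
  interpret M: real_distribution M by fact
  interpret N: real_distribution N by fact
  interpret P: pair_prob_space M N ..
  have "measure M A * measure N B = measure (M \<Otimes>\<^sub>M N) (A \<times> B)"
    by (simp add: measure_def N.emeasure_pair_measure_Times enn2real_mult)
  also have "\<dots> \<le> measure (M \<Otimes>\<^sub>M N) ((\<lambda>(x, y). x + y) -` C \<inter> space (M \<Otimes>\<^sub>M N))"
  proof (rule P.finite_measure_mono)
    show "(\<lambda>(x, y). x + y) -` C \<inter> space (M \<Otimes>\<^sub>M N) \<in> P.events"
      by (rule measurable_sets[of _ _ borel]) measurable
  qed (use C in \<open>auto simp: space_pair_measure\<close>)
  also have "\<dots> = measure (convolution M N) C"
    unfolding convolution_def by (subst measure_distr) auto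
  finally show ?thesis .
qed

text \<open>Stated for a family of sets so that it covers both tails, \<open>{real k * c..}\<close>
  and \<open>{..real k * - c}\<close>.\<close>

lemma measure_conv_power_ge:
  fixes \<nu> :: "real measure" and A :: "nat \<Rightarrow> real set"
  assumes \<nu>: "real_distribution \<nu>" and [measurable]: "\<And>k. A k \<in> sets borel"
    and "0 \<in> A 0" and A: "\<And>k x y. x \<in> A 1 \<Longrightarrow> y \<in> A k \<Longrightarrow> x + y \<in> A (Suc k)"
  shows "measure \<nu> (A 1) ^ n \<le> measure (conv_power n \<nu>) (A n)"
proof (induction n)
  case 0
  then show ?case using assms(3) by (simp add: measure_return)
next
  case (Suc n)
  have "measure \<nu> (A 1) ^ Suc n \<le> measure \<nu> (A 1) * measure (conv_power n \<nu>) (A n)"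
    using Suc by (simp add: mult_left_mono)
  also have "\<dots> \<le> measure (conv_power (Suc n) \<nu>) (A (Suc n))"
    unfolding conv_power.simps using \<nu>
    by (intro measure_convolution_ge A)
      (auto simp: real_distribution_iff_prob_space_borel prob_space_conv_power sets_conv_power)
  finally show ?case .
qed

lemma norm_tail_tendsto_0:
  fixes \<mu> :: "'a::real_normed_vector measure"
  assumes "prob_space \<mu>" and [measurable_cong]: "sets \<mu> = sets borel"
  shows "(\<lambda>k. measure \<mu> {x. real k \<le> norm x}) \<longlonglongrightarrow> 0"
proof -
  interpret prob_space \<mu> by fact
  have sp: "space \<mu> = UNIV" using sets_eq_imp_space_eq[OF assms(2)] by simp
  have "(\<Inter>k. {x :: 'a. real k \<le> norm x}) = {}"
    by (simp add: set_eq_iff not_le reals_Archimedean2)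
  moreover have "(\<lambda>k. measure \<mu> {x. real k \<le> norm x}) \<longlonglongrightarrow> measure \<mu> (\<Inter>k. {x. real k \<le> norm x})"
  proof (rule finite_Lim_measure_decseq)
    have "{x \<in> space \<mu>. real k \<le> norm x} \<in> sets \<mu>" for k by measurable
    then show "range (\<lambda>k. {x. real k \<le> norm x}) \<subseteq> sets \<mu>" by (auto simp: sp)
    show "decseq (\<lambda>k. {x :: 'a. real k \<le> norm x})" by (auto simp: decseq_def)
  qed
  ultimately show ?thesis by simp
qed

text \<open>If \<open>Z\<^sub>1, \<dots>, Z\<^sub>n\<close> are independent with law \<open>\<nu>\<close>, then \<open>P(Z\<^sub>1 \<ge> c)\<^sup>n \<le> P(Z\<^sub>1 + \<dots> + Z\<^sub>n \<ge> n c)\<close>;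
  so the convolution roots of a tight family are tight.\<close>

lemma tight_conv_roots:
  fixes \<mu> :: "(real ^ 'd) measure"
  assumes \<mu>: "prob_space \<mu>" and sets [measurable_cong]: "sets \<mu> = sets borel"
    and \<nu>: "\<And>j. real_distribution (\<nu> j)" and n: "n \<ge> 1"
    and a: "\<And>j. norm (a j) \<le> K" and root: "\<And>j. distr \<mu> borel ((\<bullet>) (a j)) = conv_power n (\<nu> j)"
  shows "tight \<nu>"
  unfolding tight_def
proof (intro conjI allI impI \<nu>)
  interpret prob_space \<mu> by fact
  have sp: "space \<mu> = UNIV" using sets_eq_imp_space_eq[OF sets] by simp
  fix \<epsilon> :: real assume "\<epsilon> > 0"
  \<comment> \<open>A strictly positive bound, so that \<open>c\<close> is positive even if
    \<open>K = 0\<close>.\<close>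
  define L where "L = max K 1"
  have L: "L > 0" "\<And>j. norm (a j) \<le> L" using a by (auto simp: L_def intro: max.coboundedI1)
  \<comment> \<open>The power leaves \<open>\<epsilon> / 2\<close> for each tail of
    \<open>\<nu> j\<close> after the \<open>n\<close>-th root is taken.\<close>
  have ev: "\<forall>\<^sub>F k in sequentially. measure \<mu> {x. real k \<le> norm x} < (\<epsilon> / 2) ^ n"
    using \<open>\<epsilon> > 0\<close> by (intro order_tendstoD[OF norm_tail_tendsto_0[OF \<mu> sets]]) auto
  obtain k where k: "k \<ge> 1" "measure \<mu> {x. real k \<le> norm x} < (\<epsilon> / 2) ^ n"
    using eventually_happens[OF eventually_conj[OF eventually_ge_at_top[of 1] ev]] by auto
  \<comment> \<open>Chosen so that \<open>n\<close> summands of size \<open>c\<close> reach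
    \<open>L * real k\<close>; a projection that large forces
    \<open>real k \<le> norm x\<close>.\<close>
  define c where "c = L * real k / real n"
  have c: "c > 0" "real n * c = L * real k" using L k n by (auto simp: c_def)
  have small: "measure (\<nu> j) (A 1) < \<epsilon> / 2"
    if A: "\<And>k. A k \<in> sets borel" "0 \<in> A 0" "\<And>k x y. x \<in> A 1 \<Longrightarrow> y \<in> A k \<Longrightarrow> x + y \<in> A (Suc k)"
      and An: "\<And>x. x \<in> A n \<Longrightarrow> L * real k \<le> \<bar>x\<bar>" for A :: "nat \<Rightarrow> real set" and j
  proof -
    note [measurable] = A(1)
    have "measure (\<nu> j) (A 1) ^ n \<le> measure (conv_power n (\<nu> j)) (A n)"
      by (rule measure_conv_power_ge[OF \<nu> A])
    also have "\<dots> = measure \<mu> {x. a j \<bullet> x \<in> A n}"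
      unfolding root[symmetric] by (subst measure_distr) (auto simp: sp vimage_def)
    also have "\<dots> \<le> measure \<mu> {x. real k \<le> norm x}"
    proof (rule finite_measure_mono)
      have "{x \<in> space \<mu>. real k \<le> norm x} \<in> sets \<mu>" by measurable
      then show "{x. real k \<le> norm x} \<in> sets \<mu>" by (simp add: sp)
      show "{x. a j \<bullet> x \<in> A n} \<subseteq> {x. real k \<le> norm x}"
      proof safe
        fix x assume "a j \<bullet> x \<in> A n"
        then have "L * real k \<le> \<bar>a j \<bullet> x\<bar>" by (rule An)
        also have "\<dots> \<le> norm (a j) * norm x" by (rule Cauchy_Schwarz_ineq2)
        also have "\<dots> \<le> L * norm x" using L by (intro mult_right_mono) auto
        finally show "real k \<le> norm x" using L by simp
      qed
    qed
    also have "\<dots> < (\<epsilon> / 2) ^ n" by (rule k)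
    finally show ?thesis
      by (rule power_less_imp_less_base) (use \<open>\<epsilon> > 0\<close> in simp)
  qed
  have "measure (\<nu> j) {-c<..c} > 1 - \<epsilon>" for j
  proof -
    interpret \<nu>: real_distribution "\<nu> j" by (rule \<nu>)
    have "measure (\<nu> j) {c..} < \<epsilon> / 2"
      using small[of "\<lambda>k. {real k * c..}" j] c by (auto simp: algebra_simps)
    moreover have "measure (\<nu> j) {..-c} < \<epsilon> / 2"
      using small[of "\<lambda>k. {..real k * - c}" j] c by (auto simp: algebra_simps)
    moreover have "measure (\<nu> j) (- {-c<..c}) \<le> measure (\<nu> j) ({c..} \<union> {..-c})"
      by (rule \<nu>.finite_measure_mono) auto
    moreover have "measure (\<nu> j) ({c..} \<union> {..-c}) \<le> measure (\<nu> j) {c..} + measure (\<nu> j) {..-c}"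
      by (rule measure_Un_le) auto
    moreover have "measure (\<nu> j) (- {-c<..c}) = 1 - measure (\<nu> j) {-c<..c}"
      using \<nu>.prob_compl[of "{-c<..c}"] by (simp add: Compl_eq_Diff_UNIV)
    ultimately show ?thesis by linarith
  qed
  then show "\<exists>a b. a < b \<and> (\<forall>j. measure (\<nu> j) {a<..b} > 1 - \<epsilon>)"
    using c by (intro exI[of _ "-c"] exI[of _ c]) auto
qed

section \<open>Directions with infinitely divisible projection: scaling, limits, open sets\<close>

definition id_directions :: "(real ^ 'd) measure \<Rightarrow> (real ^ 'd) set" where
  "id_directions \<mu> = {a. infinitely_divisible (distr \<mu> borel ((\<bullet>) a))}"

lemma id_directions_scaleR:
  assumes [measurable_cong]: "sets \<mu> = sets borel" and "a \<in> id_directions \<mu>"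
  shows "c *\<^sub>R a \<in> id_directions \<mu>"
proof -
  have "infinitely_divisible (distr (distr \<mu> borel ((\<bullet>) a)) borel (\<lambda>x. c * x))"
    using assms(2) unfolding id_directions_def mem_Collect_eq
    by (rule infinitely_divisible_distr) (auto simp: distrib_left)
  also have "distr (distr \<mu> borel ((\<bullet>) a)) borel (\<lambda>x. c * x) = distr \<mu> borel ((\<bullet>) (c *\<^sub>R a))"
    by (subst distr_distr) (auto intro!: distr_cong)
  finally show ?thesis by (simp add: id_directions_def)
qed

text \<open>Roots of the converging projections are tight, so a subsequence converges weakly.
  Convergence of the characteristic functions makes its limit a root of the limiting
  projection.\<close>

lemma id_directions_limit:
  assumes \<mu>: "prob_space \<mu>" "sets \<mu> = sets borel"
    and a: "\<And>j. a j \<in> id_directions \<mu>" and lim: "a \<longlonglongrightarrow> b"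
  shows "b \<in> id_directions \<mu>"
  unfolding id_directions_def mem_Collect_eq
    infinitely_divisible_real_iff[OF real_distribution_distr_inner[OF \<mu>]]
proof (intro allI impI)
  fix n :: nat assume n: "n \<ge> 1"
  have "\<forall>j. \<exists>\<nu>. real_distribution \<nu> \<and> distr \<mu> borel ((\<bullet>) (a j)) = conv_power n \<nu>"
    using a n unfolding id_directions_def infinitely_divisible_def real_distribution_iff_prob_space_borel by auto
  then obtain \<nu> where \<nu>: "\<And>j. real_distribution (\<nu> j)" "\<And>j. distr \<mu> borel ((\<bullet>) (a j)) = conv_power n (\<nu> j)"
    by metis
  obtain K where "\<And>j. norm (a j) \<le> K"
    using convergent_imp_Bseq[of a] lim by (auto simp: convergent_def Bseq_def)
  then have "tight \<nu>"
    by (rule tight_conv_roots[OF \<mu> \<nu>(1) n _ \<nu>(2)])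
  then obtain r \<rho> where r: "strict_mono r" and \<rho>: "real_distribution \<rho>" and conv: "weak_conv_m (\<nu> \<circ> id \<circ> r) \<rho>"
    using tight_imp_convergent_subsubsequence[of \<nu> id] by (auto simp: strict_mono_def)
  have "char (distr \<mu> borel ((\<bullet>) b)) t = char \<rho> t ^ n" for t
  proof (rule LIMSEQ_unique)
    have "weak_conv_m (\<lambda>k. \<nu> (r k)) \<rho>"
      using conv by (simp add: comp_def)
    then have "(\<lambda>k. char (\<nu> (r k)) t) \<longlonglongrightarrow> char \<rho> t"
      by (intro levy_continuity1 \<nu>(1) \<rho>)
    then have "(\<lambda>k. char (\<nu> (r k)) t ^ n) \<longlonglongrightarrow> char \<rho> t ^ n"
      by (rule tendsto_power)
    moreover have "char (\<nu> j) t ^ n = char_vec \<mu> (t *\<^sub>R a j)" for j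
      by (simp add: char_conv_power[OF \<nu>(1), symmetric] \<nu>(2)[symmetric] char_distr_inner \<mu>)
    ultimately show "(\<lambda>k. char_vec \<mu> (t *\<^sub>R a (r k))) \<longlonglongrightarrow> char \<rho> t ^ n" by simp
    have "(\<lambda>k. t *\<^sub>R a (r k)) \<longlonglongrightarrow> t *\<^sub>R b"
      using LIMSEQ_subseq_LIMSEQ[OF lim r] by (intro tendsto_intros) (simp add: comp_def)
    then show "(\<lambda>k. char_vec \<mu> (t *\<^sub>R a (r k))) \<longlonglongrightarrow> char (distr \<mu> borel ((\<bullet>) b)) t"
      unfolding char_distr_inner[OF \<mu>(2)] by (rule isCont_tendsto_compose[OF isCont_char_vec[OF \<mu>]])
  qed
  with \<rho> show "\<exists>\<nu>. real_distribution \<nu> \<and> (\<forall>t. char (distr \<mu> borel ((\<bullet>) b)) t = char \<nu> t ^ n)"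
    by blast
qed

text \<open>A vector with a rational relation lies in one of countably many hyperplanes, all of them
  null sets.\<close>

lemma exists_rat_independent_coords:
  fixes U :: "(real ^ 'd) set"
  assumes "open U" "U \<noteq> {}"
  shows "\<exists>a\<in>U. rat_independent_coords a"
proof (rule ccontr)
  assume *: "\<not> (\<exists>a\<in>U. rat_independent_coords a)"
  define H where "H q = {a :: real ^ 'd. (\<chi> i. of_rat (q i)) \<bullet> a = 0}" for q :: "'d \<Rightarrow> rat"
  have "U \<subseteq> (\<Union>q\<in>{q. q \<noteq> (\<lambda>_. 0)}. H q)"
  proof
    fix a assume "a \<in> U"
    with * obtain q i where "(\<Sum>i\<in>UNIV. of_rat (q i) * a $ i) = 0" "q i \<noteq> 0"
      by (auto simp: rat_independent_coords_def)
    then have "a \<in> H q" "q \<noteq> (\<lambda>_. 0)" by (auto simp: H_def inner_vec_def)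
    then show "a \<in> (\<Union>q\<in>{q. q \<noteq> (\<lambda>_. 0)}. H q)" by blast
  qed
  moreover have "negligible (H q)" if "q \<noteq> (\<lambda>_. 0)" for q
    unfolding H_def using that by (intro negligible_hyperplane) (auto simp: vec_eq_iff fun_eq_iff)
  then have "negligible (\<Union>q\<in>{q. q \<noteq> (\<lambda>_. 0)}. H q)"
    by (intro negligible_countable_Union countable_image) auto
  ultimately have "negligible U" by (rule negligible_subset[rotated])
  with assms open_not_negligible show False by blast
qed

text \<open>A cone over an open set contains a ball so large that it meets every coset of \<open>2 \<pi> \<int>\<^sup>d\<close>.\<close>

lemma infinitely_divisible_if_open_directions:
  fixes \<mu> :: "(real ^ 'd) measure"
  assumes \<mu>: "prob_space \<mu>" "sets \<mu> = sets borel" and lattice: "AE x in \<mu>. x \<in> int_vecs"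
    and U: "open U" "U \<noteq> {}" "U \<subseteq> id_directions \<mu>"
  shows "infinitely_divisible \<mu>"
proof -
  obtain x r where r: "r > 0" "ball x r \<subseteq> U"
    using U by (metis ex_in_conv open_contains_ball)
  have "char_vec \<mu> z \<noteq> 0" for z
  proof -
    \<comment> \<open>Dilation by \<open>T\<close> gives the ball a radius exceeding
      \<open>CARD('d) * pi\<close>, a bound for the distance from its centre to the coset of
      \<open>z\<close>.\<close>
    define T where "T = (CARD('d) * pi + 1) / r"
    have T: "T > 0" "T * r = CARD('d) * pi + 1" using r by (auto simp: T_def intro!: divide_pos_pos add_nonneg_pos)
    \<comment> \<open>Coordinatewise rounding makes \<open>y\<close> a point of the coset of
      \<open>z\<close> closest to \<open>T *\<^sub>R x\<close>.\<close>
    define k :: "real ^ 'd" where "k = (\<chi> i. of_int (round ((T * x $ i - z $ i) / (2 * pi))))"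
    define y where "y = z + (2 * pi) *\<^sub>R k"
    have k: "k \<in> int_vecs" by (simp add: k_def int_vecs_def)
    have "\<bar>(y - T *\<^sub>R x) $ i\<bar> \<le> pi" for i
    proof -
      define w where "w = (T * x $ i - z $ i) / (2 * pi)"
      have "(y - T *\<^sub>R x) $ i = 2 * pi * (of_int (round w) - w)"
        by (simp add: y_def k_def w_def field_simps)
      then have "\<bar>(y - T *\<^sub>R x) $ i\<bar> = 2 * pi * \<bar>of_int (round w) - w\<bar>"
        by (simp only: abs_mult) simp
      also have "\<dots> \<le> 2 * pi * (1 / 2)"
        using of_int_round_abs_le[of w] by (intro mult_left_mono) auto
      finally show ?thesis by simp
    qed
    then have "norm (y - T *\<^sub>R x) \<le> CARD('d) * pi"
      by (intro order.trans[OF norm_le_l1_cart] order.trans[OF sum_bounded_above]) auto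
    also have "\<dots> < T * r" using T by simp
    finally have "norm (T *\<^sub>R ((1 / T) *\<^sub>R y - x)) < T * r"
      using T by (simp add: scaleR_diff_right)
    then have "norm ((1 / T) *\<^sub>R y - x) < r"
      using T(1) by (simp only: norm_scaleR) simp
    then have "(1 / T) *\<^sub>R y \<in> id_directions \<mu>"
      using r U by (auto simp: dist_norm norm_minus_commute)
    then have "T *\<^sub>R (1 / T) *\<^sub>R y \<in> id_directions \<mu>"
      by (rule id_directions_scaleR[OF \<mu>(2)])
    then have "infinitely_divisible (distr \<mu> borel ((\<bullet>) y))"
      using T by (simp add: id_directions_def)
    \<comment> \<open>At time 1 this is the value of \<open>char_vec \<mu>\<close> at
      \<open>y\<close>, which by periodicity is its value at \<open>z\<close>.\<close>
    then have "char (distr \<mu> borel ((\<bullet>) y)) 1 \<noteq> 0"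
      by (rule infinitely_divisible_char_nonzero[OF real_distribution_distr_inner[OF \<mu>]])
    then show ?thesis
      by (simp add: char_distr_inner[OF \<mu>(2)] y_def char_vec_periodic[OF \<mu>(2) lattice k])
  qed
  moreover obtain a where "a \<in> U" "rat_independent_coords a"
    using exists_rat_independent_coords[OF U(1,2)] by blast
  ultimately show ?thesis
    using U(3) by (intro infinitely_divisible_if_rat_independent[OF \<mu> lattice])
      (auto simp: id_directions_def)
qed

text \<open>Rounding down the multiples of \<open>x\<close> gives natural vectors, and dividing by
  the multiplier gives directions that converge to \<open>x\<close>. Positivity makes
  \<open>nat\<close> harmless.\<close>

lemma positive_orthant_id_directions:
  fixes \<mu> :: "(real ^ 'd) measure"
  assumes \<mu>: "prob_space \<mu>" "sets \<mu> = sets borel"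
    and nat: "\<And>a. \<forall>i. a $ i \<in> \<nat> \<Longrightarrow> a \<in> id_directions \<mu>" and x: "\<forall>i. 0 < x $ i"
  shows "x \<in> id_directions \<mu>"
proof (rule id_directions_limit[OF \<mu>])
  define k :: "nat \<Rightarrow> real ^ 'd" where "k n = (\<chi> i. real (nat \<lfloor>real (Suc n) * x $ i\<rfloor>))" for n
  show "(1 / real (Suc n)) *\<^sub>R k n \<in> id_directions \<mu>" for n
    by (intro id_directions_scaleR[OF \<mu>(2)] nat) (simp add: k_def)
  show "(\<lambda>n. (1 / real (Suc n)) *\<^sub>R k n) \<longlonglongrightarrow> x"
  proof (rule vec_tendstoI)
    fix i
    have eq: "((1 / real (Suc n)) *\<^sub>R k n) $ i = of_int \<lfloor>real (Suc n) * x $ i\<rfloor> / real (Suc n)" for n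
      using x by (simp add: k_def less_imp_le)
    have "(\<lambda>n. of_int \<lfloor>real (Suc n) * x $ i\<rfloor> / real (Suc n)) \<longlonglongrightarrow> x $ i"
    proof (rule tendsto_sandwich)
      show "(\<lambda>n. x $ i - 1 / real (Suc n)) \<longlonglongrightarrow> x $ i" by real_asymp
      show "(\<lambda>n. x $ i) \<longlonglongrightarrow> x $ i" by simp
      show "\<forall>\<^sub>F n in sequentially. x $ i - 1 / real (Suc n) \<le> of_int \<lfloor>real (Suc n) * x $ i\<rfloor> / real (Suc n)"
      proof (rule always_eventually, rule allI)
        fix n
        have "real (Suc n) * x $ i - 1 \<le> of_int \<lfloor>real (Suc n) * x $ i\<rfloor>" by linarith
        then have "(real (Suc n) * x $ i - 1) / real (Suc n) \<le> of_int \<lfloor>real (Suc n) * x $ i\<rfloor> / real (Suc n)"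
          by (rule divide_right_mono) simp
        then show "x $ i - 1 / real (Suc n) \<le> of_int \<lfloor>real (Suc n) * x $ i\<rfloor> / real (Suc n)"
          by (simp add: diff_divide_distrib del: of_nat_Suc)
      qed
      show "\<forall>\<^sub>F n in sequentially. of_int \<lfloor>real (Suc n) * x $ i\<rfloor> / real (Suc n) \<le> x $ i"
        by (intro always_eventually allI) (simp add: divide_le_eq mult.commute del: of_nat_Suc)
    qed
    then show "(\<lambda>n. ((1 / real (Suc n)) *\<^sub>R k n) $ i) \<longlonglongrightarrow> x $ i" by (simp only: eq)
  qed
qed

text \<open>\<open>U\<close> is the preimage of a relatively open part of \<open>S\<close> under
  normalization, with the origin removed to keep that map continuous.\<close>

lemma open_cone_of_spherical_interior:
  fixes S :: "(real ^ 'd) set"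
  assumes "top_of_set (sphere 0 1) interior_of S \<noteq> {}"
  obtains U where "open U" "U \<noteq> {}" "\<And>x. x \<in> U \<Longrightarrow> (1 / norm x) *\<^sub>R x \<in> S"
proof -
  obtain u T where T: "openin (top_of_set (sphere 0 1)) T" "u \<in> T" "T \<subseteq> S"
    using assms by (auto simp: interior_of_def)
  then obtain W where W: "open W" "T = sphere 0 1 \<inter> W"
    by (auto simp: openin_open)
  define U where "U = - {0} \<inter> (\<lambda>x. (1 / norm x) *\<^sub>R x) -` W"
  show thesis
  proof
    show "open U" unfolding U_def
      by (rule continuous_open_preimage) (auto intro!: continuous_intros W)
    have "u \<in> U" using T(2) W by (auto simp: U_def)
    then show "U \<noteq> {}" by blast
    fix x assume "x \<in> U"
    then have "(1 / norm x) *\<^sub>R x \<in> T" by (simp add: W U_def)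
    then show "(1 / norm x) *\<^sub>R x \<in> S" using T by blast
  qed
qed

text \<open>Any enumeration of a countable dense subset of the sphere will do. It supplies the
  sequence in (v) once all directions are admissible.\<close>

lemma exists_dense_directions:
  "\<exists>a :: nat \<Rightarrow> real ^ 'd. (\<forall>n. a n \<noteq> 0) \<and>
     top_of_set (sphere 0 1) interior_of closure (range (\<lambda>n. (1 / norm (a n)) *\<^sub>R a n)) \<noteq> {}"
proof -
  have ne: "axis undefined 1 \<in> sphere (0 :: real ^ 'd) 1" by simp
  obtain T where T: "countable T" "T \<subseteq> sphere (0 :: real ^ 'd) 1" "sphere 0 1 \<subseteq> closure T"
    using separable by blast
  then have "T \<noteq> {}" using ne by auto
  then have rng: "range (from_nat_into T) = T" using T by simp
  then have norm: "norm (from_nat_into T n) = 1" for n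
    using T(2) by (metis mem_sphere_0 rangeI subsetD)
  have "top_of_set (sphere 0 1) interior_of closure T = sphere 0 1"
    using T(3) openin_topspace[of "top_of_set (sphere (0 :: real ^ 'd) 1)"]
    by (intro antisym interior_of_maximal) (auto simp: interior_of_subset_topspace[THEN subset_trans])
  moreover have "from_nat_into T n \<noteq> 0" for n
    using norm[of n] by auto
  ultimately show ?thesis
    using ne norm by (intro exI[of _ "from_nat_into T"]) (auto simp: rng)
qed

section \<open>Equivalence of the five conditions for a lattice-valued vector\<close>

theorem theorem4p1:
  fixes M :: "'w measure" and X :: "'w \<Rightarrow> real ^ 'd" and \<mu> :: "(real ^ 'd) measure"
  assumes prob: "prob_space M"
    and rv: "X \<in> borel_measurable M"
    and integral: "\<forall>\<omega>\<in>space M. \<forall>i. X \<omega> $ i \<in> \<int>"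
    and law: "\<mu> = distr M borel X"
  shows "(infinitely_divisible \<mu>
           \<longleftrightarrow> (\<forall>a :: real ^ 'd. infinitely_divisible (distr M borel (\<lambda>\<omega>. a \<bullet> X \<omega>))))
       \<and> (infinitely_divisible \<mu>
           \<longleftrightarrow> (\<forall>a :: real ^ 'd. (\<forall>i. a $ i \<in> \<nat>) \<longrightarrow>
                  infinitely_divisible (distr M borel (\<lambda>\<omega>. a \<bullet> X \<omega>))))
       \<and> (infinitely_divisible \<mu>
           \<longleftrightarrow> (\<forall>z. char_vec \<mu> z \<noteq> 0) \<and>
                (\<exists>a :: real ^ 'd. rat_independent_coords a \<and>
                  infinitely_divisible (distr M borel (\<lambda>\<omega>. a \<bullet> X \<omega>))))
       \<and> (infinitely_divisible \<mu>
           \<longleftrightarrow> (\<exists>a :: nat \<Rightarrow> real ^ 'd. (\<forall>n. a n \<noteq> 0) \<and>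
                  top_of_set (sphere 0 1) interior_of
                    closure (range (\<lambda>n. (1 / norm (a n)) *\<^sub>R a n)) \<noteq> {} \<and>
                  (\<forall>n. infinitely_divisible (distr M borel (\<lambda>\<omega>. a n \<bullet> X \<omega>)))))"
proof -
  note [measurable] = rv
  interpret prob_space M by fact
  have \<mu>: "prob_space \<mu>" "sets \<mu> = sets borel"
    unfolding law by (simp_all add: prob_space_distr)
  have lattice: "AE x in \<mu>. x \<in> int_vecs"
    unfolding law
  proof (subst AE_distr_iff)
    show "{x \<in> space borel. x \<in> (int_vecs :: (real ^ 'd) set)} \<in> sets borel"
      using countable_imp_borel[OF countable_int_vecs] by simp
  qed (use integral in \<open>auto simp: int_vecs_def\<close>)
  have push: "distr M borel (\<lambda>\<omega>. a \<bullet> X \<omega>) = distr \<mu> borel ((\<bullet>) a)" for a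
    unfolding law by (subst distr_distr) (auto simp: comp_def)
  have dir: "a \<in> id_directions \<mu> \<longleftrightarrow> infinitely_divisible (distr M borel (\<lambda>\<omega>. a \<bullet> X \<omega>))" for a
    by (simp add: id_directions_def push)
  have all: "a \<in> id_directions \<mu>" if "infinitely_divisible \<mu>" for a
    unfolding id_directions_def using that by (auto intro!: infinitely_divisible_distr simp: inner_add_right)
  have iii: "infinitely_divisible \<mu>" if nat: "\<And>a. \<forall>i. a $ i \<in> \<nat> \<Longrightarrow> a \<in> id_directions \<mu>"
  proof (rule infinitely_divisible_if_open_directions[OF \<mu> lattice])
    show "open {x :: real ^ 'd. \<forall>i. 0 < x $ i}"
      unfolding Collect_all_eq by (intro open_INT ballI open_Collect_less continuous_intros) simp
    have "(\<chi> i. 1) \<in> {x :: real ^ 'd. \<forall>i. 0 < x $ i}" by simp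
    then show "{x :: real ^ 'd. \<forall>i. 0 < x $ i} \<noteq> {}" by blast
    show "{x. \<forall>i. 0 < x $ i} \<subseteq> id_directions \<mu>"
      using positive_orthant_id_directions[OF \<mu> nat] by blast
  qed
  \<comment> \<open>The value at \<open>z\<close> is the characteristic function of the projection
    along \<open>z\<close> at time 1.\<close>
  have i_iv: "char_vec \<mu> z \<noteq> 0" if "infinitely_divisible \<mu>" for z
    using infinitely_divisible_char_nonzero[OF real_distribution_distr_inner[OF \<mu>], of z 1] all[OF that, of z]
    by (simp add: id_directions_def char_distr_inner \<mu>)
  have v: "infinitely_divisible \<mu>"
    if a: "top_of_set (sphere 0 1) interior_of closure (range (\<lambda>n. (1 / norm (a n)) *\<^sub>R a n)) \<noteq> {}"
      "\<And>n. a n \<in> id_directions \<mu>" for a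
  proof -
    obtain U where U: "open U" "U \<noteq> {}"
      "\<And>x. x \<in> U \<Longrightarrow> (1 / norm x) *\<^sub>R x \<in> closure (range (\<lambda>n. (1 / norm (a n)) *\<^sub>R a n))"
      using open_cone_of_spherical_interior[OF a(1)] by blast
    \<comment> \<open>The unit vector of \<open>x\<close> is a limit of rescaled admissible
      directions; scaling by \<open>norm x\<close> returns to \<open>x\<close>.\<close>
    have "x \<in> id_directions \<mu>" if "x \<in> U" for x
    proof -
      obtain b where b: "\<And>n. b n \<in> range (\<lambda>n. (1 / norm (a n)) *\<^sub>R a n)" "b \<longlonglongrightarrow> (1 / norm x) *\<^sub>R x"
        using U(3)[OF \<open>x \<in> U\<close>] unfolding closure_sequential by blast
      have "b n \<in> id_directions \<mu>" for n
        using b(1)[of n] id_directions_scaleR[OF \<mu>(2) a(2)] by auto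
      then have "(1 / norm x) *\<^sub>R x \<in> id_directions \<mu>"
        using b(2) by (rule id_directions_limit[OF \<mu>])
      then have "norm x *\<^sub>R (1 / norm x) *\<^sub>R x \<in> id_directions \<mu>"
        by (rule id_directions_scaleR[OF \<mu>(2)])
      then show ?thesis by (cases "x = 0") auto
    qed
    then show ?thesis
      using U by (intro infinitely_divisible_if_open_directions[OF \<mu> lattice]) auto
  qed
  \<comment> \<open>The witness for (iv) when every direction is admissible.\<close>
  obtain a0 :: "real ^ 'd" where a0: "rat_independent_coords a0"
    using exists_rat_independent_coords[of UNIV] by auto
  show ?thesis
    unfolding dir[symmetric]
  proof (intro conjI iffI)
    assume "(\<forall>z. char_vec \<mu> z \<noteq> 0) \<and> (\<exists>a. rat_independent_coords a \<and> a \<in> id_directions \<mu>)"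
    then show "infinitely_divisible \<mu>"
      using infinitely_divisible_if_rat_independent[OF \<mu> lattice] by (auto simp: id_directions_def)
  next
    assume id: "infinitely_divisible \<mu>"
    then show "\<exists>a :: nat \<Rightarrow> real ^ 'd. (\<forall>n. a n \<noteq> 0) \<and>
        top_of_set (sphere 0 1) interior_of closure (range (\<lambda>n. (1 / norm (a n)) *\<^sub>R a n)) \<noteq> {} \<and>
        (\<forall>n. a n \<in> id_directions \<mu>)"
      using exists_dense_directions all by blast
  qed (use all iii i_iv v a0 in blast)+
qed

end
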